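(* For $n\geq 5$, the group $UVP_n$ is a characteristic subgroup of $UVB_n$.
   Context: The unrestricted virtual braid group $UVB_n$ is the group with generators $\sigma_1,\dots,\sigma_{n-1},\rho_1,\dots,\rho_{n-1}$ and relations: $\sigma_i\sigma_{i+1}\sigma_i=\sigma_{i+1}\sigma_i\sigma_{i+1}$ ($1\le i\le n-2$); $\sigma_i\sigma_j=\sigma_j\sigma_i$ ($|i-j|>1$); $\rho_i\rho_{i+1}\rho_i=\rho_{i+1}\rho_i\rho_{i+1}$ ($1\le i\le n-2$); $\rho_i\rho_j=\rho_j\rho_i$ ($|i-j|>1$); $\rho_i^2=1$ ($1\le i\le n-1$); $\sigma_i\rho_j=\rho_j\sigma_i$ ($|i-j|>1$); $\sigma_i\rho_{i+1}\rho_i=\rho_{i+1}\rho_i\sigma_{i+1}$ ($1\le i\le n-2$); $\rho_i\sigma_{i+1}\sigma_i=\sigma_{i+1}\sigma_i\rho_{i+1}$ ($1\le i\le n-2$); $\rho_{i+1}\sigma_i\sigma_{i+1}=\sigma_i\sigma_{i+1}\rho_i$ ($1\le i\le n-2$). The unrestricted virtual pure braid group $UVP_n$ is the kernel of the homomorphism $\phi:UVB_n\to S_n$ with $\phi(\sigma_i)=\phi(\rho_i)=(i,i+1)$ for $1\le i\le n-1$. Characteristic means $f(UVP_n)=UVP_n$ for every $f\in Aut(UVB_n)$. *)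

theory Defs
  imports "HOL-Algebra.Sym_Groups" "HOL-Algebra.Bij"
begin

section \<open>Groups given by generators and relations\<close>

text \<open>A letter \<open>(s, True)\<close> stands for the generator \<open>s\<close>, a letter \<open>(s, False)\<close> for its formal
  inverse. A pair \<open>(u, v)\<close> of words stands for the relation \<open>u = v\<close>.\<close>

type_synonym 'a gword = "('a \<times> bool) list"

definition gwords :: "'a set \<Rightarrow> 'a gword set"
  where "gwords S = lists (S \<times> UNIV)"

inductive pres_eq :: "'a set \<Rightarrow> ('a gword \<times> 'a gword) set \<Rightarrow> 'a gword \<Rightarrow> 'a gword \<Rightarrow> bool"
  for S :: "'a set" and R :: "('a gword \<times> 'a gword) set" where
  refl: "w \<in> gwords S \<Longrightarrow> pres_eq S R w w"
| sym: "pres_eq S R u v \<Longrightarrow> pres_eq S R v u"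
| trans: "pres_eq S R u v \<Longrightarrow> pres_eq S R v w \<Longrightarrow> pres_eq S R u w"
| append: "pres_eq S R u u' \<Longrightarrow> pres_eq S R v v' \<Longrightarrow> pres_eq S R (u @ v) (u' @ v')"
| cancel: "s \<in> S \<Longrightarrow> pres_eq S R [(s, b), (s, \<not> b)] []"
| relation: "(u, v) \<in> R \<Longrightarrow> u \<in> gwords S \<Longrightarrow> v \<in> gwords S \<Longrightarrow> pres_eq S R u v"

definition pres_rel :: "'a set \<Rightarrow> ('a gword \<times> 'a gword) set \<Rightarrow> ('a gword \<times> 'a gword) set"
  where "pres_rel S R = {(u, v). pres_eq S R u v}"

definition presented_group :: "'a set \<Rightarrow> ('a gword \<times> 'a gword) set \<Rightarrow> 'a gword set monoid"
  where "presented_group S R =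
    \<lparr> carrier = gwords S // pres_rel S R,
      mult = (\<lambda>X Y. pres_rel S R `` {u @ v | u v. u \<in> X \<and> v \<in> Y}),
      one = pres_rel S R `` {[]} \<rparr>"

fun eval_gword :: "('b, 'c) monoid_scheme \<Rightarrow> ('a \<Rightarrow> 'b) \<Rightarrow> 'a gword \<Rightarrow> 'b" where
  "eval_gword G f [] = \<one>\<^bsub>G\<^esub>"
| "eval_gword G f ((s, b) # w) = (if b then f s else inv\<^bsub>G\<^esub> f s) \<otimes>\<^bsub>G\<^esub> eval_gword G f w"

text \<open>The homomorphism from a presented group to \<open>G\<close> that extends the map \<open>f\<close> on generators. The
  image of a class is the common value of its words; there is one whenever \<open>f\<close> respects the
  relations (\<open>presented_lift_class\<close> below).\<close>

definition presented_lift :: "('b, 'c) monoid_scheme \<Rightarrow> ('a \<Rightarrow> 'b) \<Rightarrow> 'a gword set \<Rightarrow> 'b"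
  where "presented_lift G f X = the_elem (eval_gword G f ` X)"

lemma gwords_Nil [simp]: "[] \<in> gwords S"
  by (simp add: gwords_def)

lemma gwords_Cons [simp]: "(s, b) # w \<in> gwords S \<longleftrightarrow> s \<in> S \<and> w \<in> gwords S"
  by (auto simp: gwords_def)

lemma gwords_append [simp]: "u @ v \<in> gwords S \<longleftrightarrow> u \<in> gwords S \<and> v \<in> gwords S"
  by (auto simp: gwords_def)

lemma pres_eq_gwords: "pres_eq S R u v \<Longrightarrow> u \<in> gwords S \<and> v \<in> gwords S"
  by (induction rule: pres_eq.induct) auto

lemma equiv_pres_rel: "equiv (gwords S) (pres_rel S R)"
proof (rule equivI)
  show "pres_rel S R \<subseteq> gwords S \<times> gwords S"
    using pres_eq_gwords by (auto simp: pres_rel_def)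
  show "refl_on (gwords S) (pres_rel S R)"
    by (auto simp: refl_on_def pres_rel_def intro: pres_eq.refl)
  show "sym (pres_rel S R)"
    by (auto simp: sym_def pres_rel_def intro: pres_eq.sym)
  show "trans (pres_rel S R)"
    by (rule transI) (auto simp: pres_rel_def intro: pres_eq.trans)
qed

lemma presented_mult_class:
  assumes "u \<in> gwords S" "v \<in> gwords S"
  shows "pres_rel S R `` {u} \<otimes>\<^bsub>presented_group S R\<^esub> pres_rel S R `` {v} = pres_rel S R `` {u @ v}"
proof -
  define A where "A = {u' @ v' | u' v'. u' \<in> pres_rel S R `` {u} \<and> v' \<in> pres_rel S R `` {v}}"
  have "pres_eq S R u u" "pres_eq S R v v"
    using assms by (auto intro: pres_eq.refl)
  then have mem: "u @ v \<in> A"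
    unfolding A_def pres_rel_def by blast
  have eq: "pres_eq S R (u @ v) w" if "w \<in> A" for w
    using that unfolding A_def pres_rel_def by (auto intro: pres_eq.append)
  have "pres_rel S R `` A = pres_rel S R `` {u @ v}"
  proof (intro subset_antisym subsetI)
    fix y assume "y \<in> pres_rel S R `` A"
    then obtain x where "x \<in> A" "pres_eq S R x y"
      by (auto simp: pres_rel_def)
    then have "pres_eq S R (u @ v) y" by (metis eq pres_eq.trans)
    then show "y \<in> pres_rel S R `` {u @ v}" by (simp add: pres_rel_def)
  next
    fix y assume "y \<in> pres_rel S R `` {u @ v}"
    then show "y \<in> pres_rel S R `` A" using mem by blast
  qed
  then show ?thesis by (simp add: presented_group_def A_def)
qed

lemma presented_carrier_cases:
  assumes "x \<in> carrier (presented_group S R)"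
  obtains w where "w \<in> gwords S" "x = pres_rel S R `` {w}"
  using assms by (auto simp: presented_group_def elim: quotientE)

lemma presented_class_closed:
  "w \<in> gwords S \<Longrightarrow> pres_rel S R `` {w} \<in> carrier (presented_group S R)"
  by (simp add: presented_group_def quotientI)

lemma presented_one: "\<one>\<^bsub>presented_group S R\<^esub> = pres_rel S R `` {[]}"
  by (simp add: presented_group_def)

lemma presented_left_inverse:
  "w \<in> gwords S \<Longrightarrow> \<exists>v \<in> gwords S. pres_eq S R (v @ w) []"
proof (induction w)
  case Nil
  then show ?case by (intro bexI[of _ "[]"]) (simp_all add: pres_eq.refl)
next
  case (Cons a w)
  obtain s b where a: "a = (s, b)" by fastforce
  then have s: "s \<in> S" "w \<in> gwords S" using Cons.prems by auto
  with Cons.IH obtain v where v: "v \<in> gwords S" "pres_eq S R (v @ w) []" by blast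
  have "pres_eq S R [(s, \<not> b), (s, b)] []"
    using pres_eq.cancel[OF s(1), of R "\<not> b"] by simp
  then have "pres_eq S R (v @ ([(s, \<not> b), (s, b)] @ w)) (v @ ([] @ w))"
    using v s by (intro pres_eq.append pres_eq.refl)
  then have "pres_eq S R ((v @ [(s, \<not> b)]) @ a # w) []"
    using v(2) by (auto simp: a intro: pres_eq.trans)
  then show ?case using v(1) s(1) by (intro bexI[of _ "v @ [(s, \<not> b)]"]) auto
qed

lemma group_presented_group: "group (presented_group S R)"
proof (rule groupI)
  fix x y assume "x \<in> carrier (presented_group S R)" "y \<in> carrier (presented_group S R)"
  then show "x \<otimes>\<^bsub>presented_group S R\<^esub> y \<in> carrier (presented_group S R)"
    by (elim presented_carrier_cases) (simp add: presented_mult_class presented_class_closed)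
next
  show "\<one>\<^bsub>presented_group S R\<^esub> \<in> carrier (presented_group S R)"
    by (simp add: presented_one presented_class_closed)
next
  fix x y z
  assume "x \<in> carrier (presented_group S R)" "y \<in> carrier (presented_group S R)"
    "z \<in> carrier (presented_group S R)"
  then show "x \<otimes>\<^bsub>presented_group S R\<^esub> y \<otimes>\<^bsub>presented_group S R\<^esub> z =
      x \<otimes>\<^bsub>presented_group S R\<^esub> (y \<otimes>\<^bsub>presented_group S R\<^esub> z)"
    by (elim presented_carrier_cases) (simp add: presented_mult_class)
next
  fix x assume "x \<in> carrier (presented_group S R)"
  then show "\<one>\<^bsub>presented_group S R\<^esub> \<otimes>\<^bsub>presented_group S R\<^esub> x = x"
    by (elim presented_carrier_cases) (simp add: presented_mult_class presented_one)
next
  fix x assume "x \<in> carrier (presented_group S R)"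
  then obtain w where w: "w \<in> gwords S" "x = pres_rel S R `` {w}"
    by (elim presented_carrier_cases)
  obtain v where v: "v \<in> gwords S" "pres_eq S R (v @ w) []"
    using presented_left_inverse[OF w(1)] by blast
  have "pres_rel S R `` {v @ w} = pres_rel S R `` {[]}"
    using v(2) by (intro equiv_class_eq[OF equiv_pres_rel]) (simp add: pres_rel_def)
  then show "\<exists>y\<in>carrier (presented_group S R). y \<otimes>\<^bsub>presented_group S R\<^esub> x = \<one>\<^bsub>presented_group S R\<^esub>"
    using v(1) w by (intro bexI[of _ "pres_rel S R `` {v}"])
      (simp_all add: presented_mult_class presented_one presented_class_closed)
qed

context group
begin

lemma eval_gword_closed:
  "f \<in> S \<rightarrow> carrier G \<Longrightarrow> w \<in> gwords S \<Longrightarrow> eval_gword G f w \<in> carrier G"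
proof (induction w)
  case (Cons a w)
  obtain s b where a: "a = (s, b)" by fastforce
  have "f s \<in> carrier G" using Cons.prems a by auto
  then show ?case using Cons a by simp
qed simp

lemma eval_gword_append:
  "f \<in> S \<rightarrow> carrier G \<Longrightarrow> u \<in> gwords S \<Longrightarrow> v \<in> gwords S \<Longrightarrow>
    eval_gword G f (u @ v) = eval_gword G f u \<otimes> eval_gword G f v"
proof (induction u)
  case Nil
  then show ?case by (simp add: eval_gword_closed)
next
  case (Cons a u)
  obtain s b where a: "a = (s, b)" by fastforce
  have "f s \<in> carrier G" using Cons.prems a by auto
  then show ?case using Cons a
    by (simp add: eval_gword_closed[of f S] m_assoc)
qed

lemma eval_gword_pres_eq:
  assumes f: "f \<in> S \<rightarrow> carrier G"
    and R: "\<forall>(u, v)\<in>R. eval_gword G f u = eval_gword G f v"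
  shows "pres_eq S R u v \<Longrightarrow> eval_gword G f u = eval_gword G f v"
proof (induction rule: pres_eq.induct)
  case (append u u' v v')
  then show ?case
    using pres_eq_gwords by (metis eval_gword_append[OF f])
next
  case (cancel s b)
  then have "f s \<in> carrier G" using f by auto
  then show ?case by simp
qed (use R in auto)

lemma presented_lift_class:
  assumes f: "f \<in> S \<rightarrow> carrier G"
    and R: "\<forall>(u, v)\<in>R. eval_gword G f u = eval_gword G f v"
    and w: "w \<in> gwords S"
  shows "presented_lift G f (pres_rel S R `` {w}) = eval_gword G f w"
proof -
  have "pres_eq S R w w" using w by (rule pres_eq.refl)
  then have "w \<in> pres_rel S R `` {w}" by (simp add: pres_rel_def)
  moreover have "eval_gword G f v = eval_gword G f w" if "v \<in> pres_rel S R `` {w}" for v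
    using that eval_gword_pres_eq[OF f R, of w v] by (simp add: pres_rel_def)
  ultimately have "eval_gword G f ` (pres_rel S R `` {w}) = {eval_gword G f w}"
    by blast
  then show ?thesis by (simp add: presented_lift_def)
qed

lemma presented_lift_hom:
  assumes f: "f \<in> S \<rightarrow> carrier G"
    and R: "\<forall>(u, v)\<in>R. eval_gword G f u = eval_gword G f v"
  shows "presented_lift G f \<in> hom (presented_group S R) G"
proof (rule homI)
  fix x assume "x \<in> carrier (presented_group S R)"
  then show "presented_lift G f x \<in> carrier G"
    by (elim presented_carrier_cases)
      (simp add: presented_lift_class[OF f R] eval_gword_closed[OF f])
next
  fix x y assume "x \<in> carrier (presented_group S R)" "y \<in> carrier (presented_group S R)"
  then show "presented_lift G f (x \<otimes>\<^bsub>presented_group S R\<^esub> y) =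
      presented_lift G f x \<otimes> presented_lift G f y"
    by (elim presented_carrier_cases)
      (simp add: presented_mult_class presented_lift_class[OF f R] eval_gword_append[OF f])
qed

end


section \<open>Unrestricted virtual braid groups\<close>

datatype uvb_gen = Sig nat | Rho nat

definition uvb_gens :: "nat \<Rightarrow> uvb_gen set"
  where "uvb_gens n = Sig ` {1..<n} \<union> Rho ` {1..<n}"

abbreviation sg :: "nat \<Rightarrow> uvb_gen gword" where "sg i \<equiv> [(Sig i, True)]"
abbreviation rh :: "nat \<Rightarrow> uvb_gen gword" where "rh i \<equiv> [(Rho i, True)]"

definition far :: "nat \<Rightarrow> nat \<Rightarrow> nat \<Rightarrow> bool"
  where "far n i j \<longleftrightarrow> i \<in> {1..<n} \<and> j \<in> {1..<n} \<and> \<bar>int i - int j\<bar> > 1"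

definition uvb_rels :: "nat \<Rightarrow> (uvb_gen gword \<times> uvb_gen gword) set"
  where "uvb_rels n =
    {(sg i @ sg (i+1) @ sg i, sg (i+1) @ sg i @ sg (i+1)) | i. 1 \<le> i \<and> i + 2 \<le> n} \<union>
    {(sg i @ sg j, sg j @ sg i) | i j. far n i j} \<union>
    {(rh i @ rh (i+1) @ rh i, rh (i+1) @ rh i @ rh (i+1)) | i. 1 \<le> i \<and> i + 2 \<le> n} \<union>
    {(rh i @ rh j, rh j @ rh i) | i j. far n i j} \<union>
    {(rh i @ rh i, []) | i. 1 \<le> i \<and> i + 1 \<le> n} \<union>
    {(sg i @ rh j, rh j @ sg i) | i j. far n i j} \<union>
    {(sg i @ rh (i+1) @ rh i, rh (i+1) @ rh i @ sg (i+1)) | i. 1 \<le> i \<and> i + 2 \<le> n} \<union>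
    {(rh i @ sg (i+1) @ sg i, sg (i+1) @ sg i @ rh (i+1)) | i. 1 \<le> i \<and> i + 2 \<le> n} \<union>
    {(rh (i+1) @ sg i @ sg (i+1), sg i @ sg (i+1) @ rh i) | i. 1 \<le> i \<and> i + 2 \<le> n}"

definition UVB :: "nat \<Rightarrow> uvb_gen gword set monoid"
  where "UVB n = presented_group (uvb_gens n) (uvb_rels n)"

fun uvb_perm :: "uvb_gen \<Rightarrow> nat \<Rightarrow> nat" where
  "uvb_perm (Sig i) = transpose i (i + 1)"
| "uvb_perm (Rho i) = transpose i (i + 1)"

text \<open>\<open>sym_group n\<close> multiplies by composition of functions. Under the opposite convention every
  value of \<open>uvb_phi\<close> is replaced by its inverse, so the kernel is the same.\<close>

definition uvb_phi :: "nat \<Rightarrow> uvb_gen gword set \<Rightarrow> nat \<Rightarrow> nat"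
  where "uvb_phi n = presented_lift (sym_group n) uvb_perm"

definition UVP :: "nat \<Rightarrow> uvb_gen gword set set"
  where "UVP n = kernel (UVB n) (sym_group n) (uvb_phi n)"

text \<open>\<open>auto G\<close> consists of the automorphisms that are \<open>undefined\<close> outside \<open>carrier G\<close>; as
  \<open>H \<subseteq> carrier G\<close>, this does not restrict the condition.\<close>

definition characteristic_subgroup :: "'a set \<Rightarrow> ('a, 'b) monoid_scheme \<Rightarrow> bool"
  where "characteristic_subgroup H G \<longleftrightarrow> subgroup H G \<and> (\<forall>f \<in> auto G. f ` H = H)"

lemma group_UVB: "group (UVB n)"
  by (simp add: UVB_def group_presented_group)

lemma uvb_rels_gwords: "(u, v) \<in> uvb_rels n \<Longrightarrow> u \<in> gwords (uvb_gens n) \<and> v \<in> gwords (uvb_gens n)"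
  by (auto simp: uvb_rels_def uvb_gens_def far_def)

lemma uvb_perm_closed: "uvb_perm \<in> uvb_gens n \<rightarrow> carrier (sym_group n)"
  by (auto simp: uvb_gens_def sym_group_def intro!: permutes_swap_id)

lemma transpose_braid:
  "transpose i (Suc i) \<circ> (transpose (Suc i) (Suc (Suc i)) \<circ> transpose i (Suc i)) =
    transpose (Suc i) (Suc (Suc i)) \<circ> (transpose i (Suc i) \<circ> transpose (Suc i) (Suc (Suc i)))"
  by (rule ext) (simp add: transpose_def)

lemma transpose_far:
  "far n i j \<Longrightarrow>
    transpose i (Suc i) \<circ> transpose j (Suc j) = transpose j (Suc j) \<circ> transpose i (Suc i)"
  by (rule ext) (auto simp: far_def transpose_def)

lemma uvb_perm_rels:
  "\<forall>(u, v)\<in>uvb_rels n.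
    eval_gword (sym_group n) uvb_perm u = eval_gword (sym_group n) uvb_perm v"
  unfolding uvb_rels_def ball_Un
  by (intro conjI ballI; elim CollectE exE conjE;
      simp add: sym_group_def transpose_braid; erule transpose_far)

lemma uvb_phi_hom: "uvb_phi n \<in> hom (UVB n) (sym_group n)"
  unfolding uvb_phi_def UVB_def
  by (intro group.presented_lift_hom sym_group_is_group uvb_perm_closed uvb_perm_rels)

lemma uvb_phi_gen:
  assumes "s \<in> uvb_gens n"
  shows "uvb_phi n (pres_rel (uvb_gens n) (uvb_rels n) `` {[(s, True)]}) = uvb_perm s"
proof -
  have "uvb_phi n (pres_rel (uvb_gens n) (uvb_rels n) `` {[(s, True)]})
      = eval_gword (sym_group n) uvb_perm [(s, True)]"
    unfolding uvb_phi_def using assms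
    by (intro group.presented_lift_class sym_group_is_group uvb_perm_closed uvb_perm_rels) auto
  then show ?thesis by (simp add: sym_group_def)
qed

end

theory Submission
  imports Defs
begin

text \<open>
  Let \<open>\<phi>\<close> be the permutation homomorphism and let \<open>f\<close> be an automorphism of \<open>UVB\<^sub>n\<close>. Then
  \<open>\<psi> = \<phi> \<circ> f\<close> is a surjection onto \<open>S\<^sub>n\<close>, and it is enough to see that \<open>\<psi>\<close> kills \<open>UVP\<^sub>n\<close>: this says
  \<open>f(UVP\<^sub>n) \<subseteq> UVP\<^sub>n\<close>, and the same inclusion for the inverse of \<open>f\<close> gives equality.

  The reason is that \<open>UVP\<^sub>n\<close> splits into commuting pieces that \<open>UVB\<^sub>n\<close> permutes, whereas \<open>S\<^sub>n\<close> has no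
  room for such a splitting. Put \<open>\<lambda>\<^bsub>1,2\<^esub> = \<sigma>\<^sub>1\<rho>\<^sub>1\<close>, and let \<open>\<lambda>\<^bsub>i,j\<^esub>\<close> be its conjugate by any word in the
  \<open>\<rho>\<close>'s whose permutation sends \<open>(1, 2)\<close> to \<open>(i, j)\<close>. In terms of these elements
  \<open>\<sigma>\<^sub>i = \<lambda>\<^bsub>i,i+1\<^esub>\<rho>\<^sub>i\<close>, and the relations that involve only \<open>\<sigma>\<close>'s, together with the two forbidden moves,
  turn into the statement that \<open>\<lambda>\<^bsub>i,j\<^esub>\<close> and \<open>\<lambda>\<^bsub>k,l\<^esub>\<close> commute as soon as the sets \<open>{i, j}\<close> and
  \<open>{k, l}\<close> differ (\<open>lam_commute\<close>). The \<open>\<lambda>\<close>'s generate the kernel \<open>UVP\<^sub>n\<close> of \<open>\<phi>\<close> (\<open>kernel_eq_P\<close>), because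
  modulo them only the \<open>\<rho>\<close>'s remain, and the Coxeter relations among the \<open>\<rho>\<close>'s already present
  the symmetric group (\<open>W_trivial\<close>).

  Hence \<open>UVP\<^sub>n = A B\<close>, where \<open>A\<close> is generated by \<open>\<lambda>\<^bsub>1,2\<^esub>, \<lambda>\<^bsub>2,1\<^esub>\<close> and \<open>B\<close> by the other \<open>\<lambda>\<close>'s, and
  \<open>\<psi>(A)\<close>, \<open>\<psi>(B)\<close> are commuting subgroups whose product is normal in \<open>S\<^sub>n\<close>. For \<open>n \<ge> 5\<close> a nontrivial
  normal subgroup contains \<open>A\<^sub>n\<close>, so both factors are normalised by \<open>A\<^sub>n\<close>; two nontrivial such subgroups
  cannot commute (\<open>commuting_factors_of_normal_subgroup_sym\<close>). So \<open>\<psi>\<close> kills \<open>A\<close> or \<open>B\<close>, in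
  particular one of the \<open>\<lambda>\<close>'s; all of them are conjugate, so it kills \<open>UVP\<^sub>n\<close>
  (\<open>surjective_hom_trivial_on_P\<close>).
\<close>

section \<open>Commuting factors of normal subgroups of symmetric groups\<close>

lemma obtain_outside:
  assumes "length xs < n"
  shows "\<exists>y::nat. y \<in> {1..n} \<and> y \<notin> set xs"
proof -
  have "card (set xs) < card {1..n}"
    using assms card_length[of xs] by simp
  then have "\<not> {1..n} \<subseteq> set xs"
    by (metis card_mono finite_set leD)
  then show ?thesis by blast
qed

text \<open>Extending a partial injection to a permutation, one point at a time: once the tail is mapped
  correctly, a transposition of two values outside the image of the tail corrects the head.\<close>

lemma permutes_map_lists:
  assumes "distinct xs" "distinct ys" "length xs = length ys" "set xs \<subseteq> S" "set ys \<subseteq> S"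
  shows "\<exists>x. x permutes S \<and> map x xs = ys"
  using assms(3,1,2,4,5)
proof (induction xs ys rule: list_induct2)
  case Nil
  then show ?case by (auto intro: permutes_id)
next
  case (Cons a as b bs)
  then obtain x where x: "x permutes S" "map x as = bs"
    by auto
  have "x a \<in> S" "b \<in> S"
    using Cons.prems permutes_in_image[OF x(1)] by auto
  then have "transpose (x a) b \<circ> x permutes S"
    using x(1) by (intro permutes_compose permutes_swap_id)
  moreover have "transpose (x a) b (x t) = x t" if "t \<in> set as" for t
  proof (rule transpose_apply_other)
    show "x t \<noteq> x a"
      using that Cons.prems(1) by (auto simp: inj_eq[OF permutes_inj[OF x(1)]])
    show "x t \<noteq> b"
      using that Cons.prems(2) x(2) by auto
  qed
  then have "map (transpose (x a) b \<circ> x) as = map x as"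
    by (intro map_cong) auto
  then have "map (transpose (x a) b \<circ> x) (a # as) = b # bs"
    using x(2) by (simp only: list.map comp_apply transpose_apply_first)
  ultimately show ?case by (intro exI conjI)
qed

text \<open>The two spare points absorb a transposition, which repairs the parity.\<close>

lemma even_permutation_map_lists:
  assumes "distinct xs" "distinct ys" "length xs = length ys"
    "set xs \<subseteq> {1..n}" "set ys \<subseteq> {1..n}" "length xs + 2 \<le> n"
  shows "\<exists>x \<in> carrier (alt_group n). map x xs = ys"
proof -
  obtain x where x: "x permutes {1..n}" "map x xs = ys"
    using permutes_map_lists[OF assms(1-5)] by auto
  obtain p where p: "p \<in> {1..n}" "p \<notin> set ys"
    using obtain_outside[of ys n] assms(3,6) by force
  obtain q where q: "q \<in> {1..n}" "q \<notin> set (p # ys)"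
    using obtain_outside[of "p # ys" n] assms(3,6) by force
  have perm: "permutation x"
    using permutes_imp_permutation[OF _ x(1)] by simp
  show ?thesis
  proof (cases "evenperm x")
    case True
    then show ?thesis using x by (intro bexI[of _ x]) (simp_all add: alt_group_carrier)
  next
    case False
    have "transpose p q \<circ> x permutes {1..n}"
      using x(1) p q by (intro permutes_compose permutes_swap_id)
    moreover have "evenperm (transpose p q \<circ> x)"
      using False q perm by (auto simp: evenperm_comp permutation_swap_id evenperm_swap)
    moreover have "transpose p q (x t) = x t" if "t \<in> set xs" for t
      using that x(2) p q by (intro transpose_apply_other) auto
    then have "map (transpose p q \<circ> x) xs = map x xs"
      by (intro map_cong) auto
    then have "map (transpose p q \<circ> x) xs = ys"
      using x(2) by simp
    ultimately show ?thesis
      by (intro bexI[of _ "transpose p q \<circ> x"]) (simp_all add: alt_group_carrier)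
  qed
qed

lemma conj_apply:
  assumes "x permutes S" shows "(x \<circ> k \<circ> inv' x) (x t) = x (k t)"
  using permutes_inverses(2)[OF assms] by simp

text \<open>If \<open>h\<close> commutes with \<open>k' = x k x\<^sup>-\<^sup>1\<close> and \<open>h u = v\<close>, then \<open>k' u\<close> determines \<open>k' v = h (k' u)\<close>. But
  the even permutation \<open>x\<close> can be chosen so that \<open>k'\<close> takes a prescribed value at \<open>u\<close> and a value
  different from \<open>h (k' u)\<close> at \<open>v\<close>, since five points leave enough freedom.\<close>

lemma not_commute_with_even_conjugates:
  assumes n: "n \<ge> 5"
    and h: "h permutes {1..n}" "h \<noteq> id"
    and k: "k permutes {1..n}" "k \<noteq> id"
  shows "\<exists>x \<in> carrier (alt_group n). h \<circ> (x \<circ> k \<circ> inv' x) \<noteq> (x \<circ> k \<circ> inv' x) \<circ> h"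
proof (rule ccontr)
  assume "\<not> ?thesis"
  then have comm: "h \<circ> (x \<circ> k \<circ> inv' x) = (x \<circ> k \<circ> inv' x) \<circ> h" if "x \<in> carrier (alt_group n)" for x
    using that by blast
  have comm': "h (x (k s)) = x (k t)"
    if "x \<in> carrier (alt_group n)" "h (x s) = x t" for x s t
  proof -
    have x: "x permutes {1..n}" using that by (simp add: alt_group_carrier)
    show ?thesis
      using fun_cong[OF comm[OF that(1)], of "x s"] that(2) conj_apply[OF x, of k] by simp
  qed
  obtain u where u: "h u \<noteq> u" using h(2) by fastforce
  obtain a where a: "k a \<noteq> a" using k(2) by fastforce
  define v b where "v = h u" and "b = k a"
  have uv: "u \<in> {1..n}" "v \<in> {1..n}" "u \<noteq> v"
    using u permutes_not_in[OF h(1)] permutes_in_image[OF h(1)] unfolding v_def by metis+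
  have ab: "a \<in> {1..n}" "b \<in> {1..n}" "a \<noteq> b"
    using a permutes_not_in[OF k(1)] permutes_in_image[OF k(1)] unfolding b_def by metis+
  \<comment> \<open>If \<open>k b \<noteq> a\<close>, some conjugate sends \<open>u\<close> to \<open>v\<close> but \<open>v\<close> to a point different from \<open>h v\<close>.\<close>
  have kb: "k b = a"
  proof (rule ccontr)
    assume ne: "k b \<noteq> a"
    have "k b \<noteq> b"
      using ab(3) inj_eq[OF permutes_inj[OF k(1)]] unfolding b_def by metis
    moreover have "k b \<in> {1..n}" using ab permutes_in_image[OF k(1)] by blast
    moreover obtain y where "y \<in> {1..n}" "y \<notin> set [u, v, h v]"
      using obtain_outside[of "[u, v, h v]" n] n by force
    ultimately obtain x where "x \<in> carrier (alt_group n)" "map x [a, b, k b] = [u, v, y]"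
      using even_permutation_map_lists[of "[a, b, k b]" "[u, v, y]" n] ab uv ne n by auto
    then show False
      using comm'[of x a b] \<open>y \<notin> _\<close> by (auto simp: v_def b_def)
  qed
  obtain d where d: "d \<in> {1..n}" "d \<notin> set [a, b]"
    using obtain_outside[of "[a, b]" n] n by force
  obtain w where w: "w \<in> {1..n}" "w \<notin> set [u, v]"
    using obtain_outside[of "[u, v]" n] n by force
  \<comment> \<open>Now \<open>k\<close> swaps \<open>a\<close> and \<open>b\<close>. A conjugate that swaps \<open>u\<close> and \<open>w\<close> has to send \<open>v\<close> to \<open>h w\<close>.\<close>
  have hw: "h w \<noteq> v"
    using w inj_eq[OF permutes_inj[OF h(1)]] unfolding v_def by auto
  show False
  proof (cases "k d = d")
    case True
    obtain x where "x \<in> carrier (alt_group n)" "map x [a, b, d] = [u, w, v]"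
      using even_permutation_map_lists[of "[a, b, d]" "[u, w, v]" n] ab d uv w n by auto
    then show False
      using comm'[of x a d] hw True by (auto simp: v_def b_def)
  next
    case False
    have e: "k d \<in> {1..n}" "k d \<noteq> a" "k d \<noteq> b"
      using d permutes_in_image[OF k(1), of d] inj_eq[OF permutes_inj[OF k(1)], of d a]
        inj_eq[OF permutes_inj[OF k(1)], of d b] kb by (auto simp: b_def)
    obtain y where y: "y \<in> {1..n}" "y \<notin> set [u, v, w, h w]"
      using obtain_outside[of "[u, v, w, h w]" n] n by force
    obtain x where x: "x permutes {1..n}" "map x [a, b, d, k d] = [u, w, v, y]"
      using permutes_map_lists[of "[a, b, d, k d]" "[u, w, v, y]" "{1..n}"] ab d uv w e y False
      by auto
    show False
    proof (cases "evenperm x")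
      case True
      then show False
        using comm'[of x a d] x y by (auto simp: v_def b_def alt_group_carrier)
    next
      case odd: False
      \<comment> \<open>As \<open>k\<close> swaps \<open>a\<close> and \<open>b\<close>, composing \<open>x\<close> with their transposition changes its parity but not the conjugate.\<close>
      let ?x = "x \<circ> transpose a b"
      have "permutation x"
        using permutes_imp_permutation[OF _ x(1)] by simp
      then have "?x \<in> carrier (alt_group n)"
        using odd x(1) ab
        by (auto simp: alt_group_carrier evenperm_comp permutation_swap_id evenperm_swap
            intro!: permutes_compose permutes_swap_id)
      moreover have "?x b = u" "?x a = w" "?x d = v" "?x (k d) = y"
        using x(2) d e by auto
      ultimately show False
        using comm'[of ?x b d] y kb by (auto simp: v_def simp del: comp_apply)
    qed
  qed
qed

text \<open>The commutator of \<open>k\<close> with a transposition of \<open>x\<close> and \<open>y\<close> is the product of the transpositions of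
  \<open>k x, k y\<close> and of \<open>x, y\<close>. A suitable choice of \<open>x\<close> and \<open>y\<close>, repeated if the first product is a pair of disjoint transpositions,
  makes them overlap in one point, so that the product is a 3-cycle; and the 3-cycles are all conjugate and
  generate the alternating group.\<close>

lemma normal_subgroup_sym_contains_alt:
  assumes n: "n \<ge> 5" and K: "K \<lhd> sym_group n" and nt: "K \<noteq> {id}"
  shows "carrier (alt_group n) \<subseteq> K"
proof -
  interpret S: group "sym_group n" by (rule sym_group_is_group)
  interpret K: subgroup K "sym_group n" using K by (rule normal_imp_subgroup)
  have Kperm: "k permutes {1..n}" if "k \<in> K" for k
    using K.subset that by (auto simp: sym_group_carrier)
  have Kconj: "x \<circ> k \<circ> inv' x \<in> K" if "x permutes {1..n}" "k \<in> K" for x k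
    using normal.inv_op_closed2[OF K, of x k] that
    by (simp add: sym_group_carrier sym_group_mult comp_assoc)
  have comm: "transpose (k x) (k y) \<circ> transpose x y \<in> K"
    if k: "k \<in> K" and xy: "x \<in> {1..n}" "y \<in> {1..n}" for k x y
  proof -
    have k': "k permutes {1..n}" by (rule Kperm[OF k])
    have t: "transpose x y permutes {1..n}" by (rule permutes_swap_id[OF xy])
    have "inv' k \<in> K" using K.m_inv_closed[OF k] k' by (simp add: sym_group_carrier)
    then have "transpose x y \<circ> inv' k \<circ> transpose x y \<in> K"
      using Kconj[OF t] by simp
    then have "k \<circ> (transpose x y \<circ> inv' k \<circ> transpose x y) \<in> K"
      using K.m_closed[OF k] by (simp add: sym_group_mult)
    moreover have "k \<circ> cycle_of_list [x, y] \<circ> inv' k = cycle_of_list (map k [x, y])"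
      if "x \<noteq> y" using that permutes_bij[OF k'] by (intro conjugation_of_cycle) auto
    then have "k \<circ> transpose x y \<circ> inv' k = transpose (k x) (k y)"
      by (cases "x = y") (simp_all add: permutes_inv_o[OF k'] id_def[symmetric])
    ultimately show ?thesis by (simp add: comp_assoc[symmetric])
  qed
  have closed: "k x \<in> {1..n}" if "k \<in> K" "x \<in> {1..n}" for k x
    using permutes_in_image[OF Kperm] that by blast
  obtain k where k: "k \<in> K" "k \<noteq> id"
    using nt K.one_closed by (auto simp: sym_group_one)
  obtain a where ka: "k a \<noteq> a" using k(2) by fastforce
  define b where "b = k a"
  have ab: "a \<in> {1..n}" "b \<in> {1..n}" "a \<noteq> b"
    using ka permutes_not_in[OF Kperm[OF k(1)]] closed[OF k(1)] unfolding b_def by metis+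
  have inj: "k s = k t \<longleftrightarrow> s = t" for s t
    by (rule inj_eq[OF permutes_inj[OF Kperm[OF k(1)]]])
  have "\<exists>cs. distinct cs \<and> length cs = 3 \<and> set cs \<subseteq> {1..n} \<and> cycle_of_list cs \<in> K"
  proof (cases "k b = a")
    case False
    have "k b \<noteq> b" using ab(3) inj[of b a] by (simp add: b_def)
    moreover have "transpose (k b) b \<circ> transpose b a \<in> K"
      using comm[OF k(1) ab(1,2)] by (simp add: b_def transpose_commute)
    ultimately show ?thesis
      using False ab closed[OF k(1) ab(2)] by (intro exI[of _ "[k b, b, a]"]) auto
  next
    case kb: True
    obtain c where c: "c \<in> {1..n}" "c \<notin> set [a, b]"
      using obtain_outside[of "[a, b]" n] n by force
    have m: "transpose b (k c) \<circ> transpose a c \<in> K"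
      using comm[OF k(1) ab(1) c(1)] by (simp add: b_def)
    show ?thesis
    proof (cases "k c = c")
      case True
      then show ?thesis
        using m c ab by (intro exI[of _ "[b, c, a]"]) (auto simp: transpose_commute)
    next
      case False
      have kc: "k c \<noteq> a" "k c \<noteq> b"
        using c inj[of c b] inj[of c a] kb by (auto simp: b_def)
      obtain e where e: "e \<in> {1..n}" "e \<notin> set [a, b, c, k c]"
        using obtain_outside[of "[a, b, c, k c]" n] n by force
      have "transpose c e \<circ> transpose e a \<in> K"
        using comm[OF m ab(1) e(1)] c e kc False by (simp add: transpose_commute)
      then show ?thesis
        using c e ab by (intro exI[of _ "[c, e, a]"]) auto
    qed
  qed
  then obtain cs where cs: "distinct cs" "length cs = 3" "set cs \<subseteq> {1..n}" "cycle_of_list cs \<in> K"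
    by blast
  have "three_cycles n \<subseteq> K"
  proof clarify
    fix ds :: "nat list" assume ds: "distinct ds" "length ds = 3" "set ds \<subseteq> {1..n}"
    then obtain x where x: "x permutes {1..n}" "map x cs = ds"
      using permutes_map_lists[OF cs(1) ds(1) _ cs(3) ds(3)] cs(2) by auto
    have "x \<circ> cycle_of_list cs \<circ> inv' x = cycle_of_list ds"
      using conjugation_of_cycle[OF cs(1) permutes_bij[OF x(1)]] x(2) by simp
    then show "cycle_of_list ds \<in> K" using Kconj[OF x(1) cs(4)] by simp
  qed
  interpret A: group "alt_group n" by (rule alt_group_is_group)
  have "generate (sym_group n) (three_cycles n) \<subseteq> K"
    using S.generate_subgroup_incl[OF \<open>three_cycles n \<subseteq> K\<close> K.subgroup_axioms] .
  moreover have "generate (alt_group n) (three_cycles n) = generate (sym_group n) (three_cycles n)"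
    using S.generate_consistent[OF three_cycles_incl alt_group_is_subgroup]
    by (simp add: alt_group_def sym_group_def)
  ultimately show ?thesis by (simp add: alt_group_carrier_as_three_cycles)
qed

text \<open>As the factors commute, conjugating an element of \<open>B\<close> by \<open>a b\<close> is the same as conjugating it by \<open>b\<close>.
  So \<open>B\<close> is normalised by the whole product, hence by the alternating group if the product is nontrivial.\<close>

lemma commuting_factors_of_normal_subgroup_sym:
  assumes n: "n \<ge> 5" and K: "A <#>\<^bsub>sym_group n\<^esub> B \<lhd> sym_group n"
    and A: "subgroup A (sym_group n)" and B: "subgroup B (sym_group n)"
    and comm: "\<And>a b. a \<in> A \<Longrightarrow> b \<in> B \<Longrightarrow> a \<circ> b = b \<circ> a"
  shows "A = {id} \<or> B = {id}"
proof (rule ccontr)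
  interpret A: subgroup A "sym_group n" by (rule A)
  interpret B: subgroup B "sym_group n" by (rule B)
  have perm: "a permutes {1..n}" if "a \<in> A \<or> a \<in> B" for a
    using A.subset B.subset that by (auto simp: sym_group_carrier)
  assume "\<not> ?thesis"
  then obtain h k where h: "h \<in> A" "h \<noteq> id" and k: "k \<in> B" "k \<noteq> id"
    using A.one_closed B.one_closed by (auto simp: sym_group_one)
  have prod: "a \<circ> b \<in> A <#>\<^bsub>sym_group n\<^esub> B" if "a \<in> A" "b \<in> B" for a b
    using that by (auto simp: set_mult_def sym_group_mult)
  have "h \<in> A <#>\<^bsub>sym_group n\<^esub> B"
    using prod[OF h(1) B.one_closed] by (simp add: sym_group_one)
  with h(2) have alt: "carrier (alt_group n) \<subseteq> A <#>\<^bsub>sym_group n\<^esub> B"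
    by (intro normal_subgroup_sym_contains_alt[OF n K]) auto
  have "h \<circ> (x \<circ> k \<circ> inv' x) = (x \<circ> k \<circ> inv' x) \<circ> h" if "x \<in> carrier (alt_group n)" for x
  proof -
    have "x \<in> A <#>\<^bsub>sym_group n\<^esub> B" using alt that by blast
    then obtain a b where ab: "a \<in> A" "b \<in> B" "x = a \<circ> b"
      by (auto simp: set_mult_def sym_group_mult)
    then have "x = b \<circ> a" using comm by simp
    have "inv' b \<in> B" using B.m_inv_closed[OF ab(2)] B.subset ab(2) by auto
    then have "b \<circ> k \<circ> inv' b \<in> B"
      using B.m_closed ab(2) k(1) by (simp add: sym_group_mult)
    moreover have "x \<circ> k \<circ> inv' x = b \<circ> (a \<circ> k \<circ> inv' a) \<circ> inv' b"
      using permutes_bij[OF perm, of a] permutes_bij[OF perm, of b] ab(1,2) \<open>x = b \<circ> a\<close>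
      by (simp add: o_inv_distrib comp_assoc)
    moreover have "a \<circ> k \<circ> inv' a = k"
      using comm[OF ab(1) k(1)] permutes_inv_o(1)[of a "{1..n}"] perm ab(1) by (simp add: comp_assoc)
    ultimately show ?thesis using comm[OF h(1)] by simp
  qed
  then show False
    using not_commute_with_even_conjugates[OF n _ h(2) _ k(2)] perm h(1) k(1) by blast
qed

section \<open>Generated subgroups and conjugation\<close>

context group
begin

text \<open>For proving that a set of normal forms that contains \<open>\<one>\<close> is all of \<open>generate G X\<close>.\<close>

lemma generate_left_closed:
  assumes X: "X \<subseteq> carrier G" and U: "U \<subseteq> carrier G"
    and step: "\<And>x u. x \<in> X \<Longrightarrow> u \<in> U \<Longrightarrow> x \<otimes> u \<in> U \<and> inv x \<otimes> u \<in> U"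
    and g: "g \<in> generate G X" and u: "u \<in> U"
  shows "g \<otimes> u \<in> U"
  using g u
proof (induction g arbitrary: u rule: generate.induct)
  case one
  then show ?case using U by auto
next
  case (eng g h)
  then have "g \<in> carrier G" "h \<in> carrier G" "u \<in> carrier G"
    using generate_in_carrier[OF X] U by auto
  then show ?case using eng by (simp add: m_assoc)
qed (use step in auto)

lemma commute_inv:
  assumes "x \<in> carrier G" "y \<in> carrier G" "x \<otimes> y = y \<otimes> x"
  shows "x \<otimes> inv y = inv y \<otimes> x"
  using assms by (metis inv_closed inv_solve_left m_assoc m_closed r_inv r_one inv_solve_right')

lemma commute_generate:
  assumes X: "X \<subseteq> carrier G" and g: "g \<in> carrier G"
    and comm: "\<And>x. x \<in> X \<Longrightarrow> g \<otimes> x = x \<otimes> g" and h: "h \<in> generate G X"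
  shows "g \<otimes> h = h \<otimes> g"
  using h
proof (induction h rule: generate.induct)
  case (inv x)
  then show ?case using commute_inv[OF g _ comm] X by auto
next
  case (eng h k)
  then have "h \<in> carrier G" "k \<in> carrier G"
    using generate_in_carrier[OF X] by auto
  then show ?case using eng g by (metis m_assoc)
qed (use g comm in auto)

lemma generates_commute:
  assumes X: "X \<subseteq> carrier G" and Y: "Y \<subseteq> carrier G"
    and comm: "\<And>x y. x \<in> X \<Longrightarrow> y \<in> Y \<Longrightarrow> x \<otimes> y = y \<otimes> x"
    and g: "g \<in> generate G X" and h: "h \<in> generate G Y"
  shows "g \<otimes> h = h \<otimes> g"
proof (rule commute_generate[OF Y _ _ h])
  show "g \<in> carrier G" using generate_in_carrier[OF X g] .
  show "g \<otimes> y = y \<otimes> g" if y: "y \<in> Y" for y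
  proof (rule commute_generate[OF X _ _ g, symmetric])
    show "y \<in> carrier G" using y Y by auto
    show "y \<otimes> x = x \<otimes> y" if "x \<in> X" for x using comm[OF that y] by simp
  qed
qed

lemma generate_Un_commuting:
  assumes X: "X \<subseteq> carrier G" and Y: "Y \<subseteq> carrier G"
    and comm: "\<And>x y. x \<in> X \<Longrightarrow> y \<in> Y \<Longrightarrow> x \<otimes> y = y \<otimes> x"
  shows "generate G (X \<union> Y) = generate G X <#> generate G Y"
proof
  interpret A: subgroup "generate G X" G by (rule generate_is_subgroup[OF X])
  interpret B: subgroup "generate G Y" G by (rule generate_is_subgroup[OF Y])
  have AC: "a \<in> carrier G" if "a \<in> generate G X" for a using that by (rule A.mem_carrier)
  have BC: "b \<in> carrier G" if "b \<in> generate G Y" for b using that by (rule B.mem_carrier)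
  have left: "a' \<otimes> u \<in> generate G X <#> generate G Y"
    if a': "a' \<in> generate G X" and u: "u \<in> generate G X <#> generate G Y" for a' u
  proof -
    obtain a b where ab: "a \<in> generate G X" "b \<in> generate G Y" "u = a \<otimes> b"
      using u by (auto simp: set_mult_def)
    then have "a' \<otimes> u = (a' \<otimes> a) \<otimes> b"
      using a' AC BC by (simp add: m_assoc)
    then show ?thesis using ab a' by (auto simp: set_mult_def)
  qed
  have right: "b' \<otimes> u \<in> generate G X <#> generate G Y"
    if b': "b' \<in> generate G Y" and u: "u \<in> generate G X <#> generate G Y" for b' u
  proof -
    obtain a b where ab: "a \<in> generate G X" "b \<in> generate G Y" "u = a \<otimes> b"
      using u by (auto simp: set_mult_def)
    have "b' \<otimes> u = (b' \<otimes> a) \<otimes> b"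
      using ab b' AC BC by (simp add: m_assoc)
    also have "\<dots> = a \<otimes> (b' \<otimes> b)"
      using generates_commute[OF X Y comm ab(1) b'] ab b' AC BC by (metis m_assoc)
    finally show ?thesis using ab b' by (auto simp: set_mult_def)
  qed
  show "generate G (X \<union> Y) \<subseteq> generate G X <#> generate G Y"
  proof
    fix g assume g: "g \<in> generate G (X \<union> Y)"
    have "\<one> \<otimes> \<one> \<in> generate G X <#> generate G Y"
      unfolding set_mult_def using A.one_closed B.one_closed by blast
    then have "\<one> \<in> generate G X <#> generate G Y" by simp
    moreover have "x \<otimes> u \<in> generate G X <#> generate G Y \<and> inv x \<otimes> u \<in> generate G X <#> generate G Y"
      if "x \<in> X \<union> Y" "u \<in> generate G X <#> generate G Y" for x u
      using that left right generate.incl generate.inv by (metis Un_iff)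
    ultimately have "g \<otimes> \<one> \<in> generate G X <#> generate G Y"
      using X Y g set_mult_closed[OF A.subset B.subset]
      by (intro generate_left_closed[of "X \<union> Y"]) auto
    moreover have "g \<in> carrier G" using generate_in_carrier[OF _ g] X Y by auto
    ultimately show "g \<in> generate G X <#> generate G Y" by simp
  qed
  show "generate G X <#> generate G Y \<subseteq> generate G (X \<union> Y)"
    using mono_generate[of X "X \<union> Y"] mono_generate[of Y "X \<union> Y"]
    by (auto simp: set_mult_def intro: generate.eng)
qed

lemma conj_mult:
  assumes "g \<in> carrier G" "x \<in> carrier G" "y \<in> carrier G"
  shows "g \<otimes> (x \<otimes> y) \<otimes> inv g = (g \<otimes> x \<otimes> inv g) \<otimes> (g \<otimes> y \<otimes> inv g)"
proof -
  have "inv g \<otimes> (g \<otimes> (y \<otimes> inv g)) = y \<otimes> inv g"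
    using assms by (metis inv_closed l_inv l_one m_assoc m_closed)
  then show ?thesis using assms by (simp add: m_assoc)
qed

lemma conj_conj:
  assumes "g \<in> carrier G" "h \<in> carrier G" "x \<in> carrier G"
  shows "(g \<otimes> h) \<otimes> x \<otimes> inv (g \<otimes> h) = g \<otimes> (h \<otimes> x \<otimes> inv h) \<otimes> inv g"
  using assms by (simp add: inv_mult_group m_assoc)

lemma conj_of_commuting:
  assumes "g \<in> carrier G" "x \<in> carrier G" "x \<otimes> g = g \<otimes> x"
  shows "g \<otimes> x \<otimes> inv g = x"
  using assms(1,2) by (simp add: assms(3)[symmetric] m_assoc)

lemma generate_conj_closed:
  assumes X: "X \<subseteq> carrier G" and g: "g \<in> carrier G"
    and step: "\<And>x. x \<in> X \<Longrightarrow> g \<otimes> x \<otimes> inv g \<in> generate G X" and h: "h \<in> generate G X"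
  shows "g \<otimes> h \<otimes> inv g \<in> generate G X"
  using h
proof (induction h rule: generate.induct)
  case one
  then show ?case using g by (simp add: generate.one)
next
  case (inv x)
  then have x: "x \<in> carrier G" using X by auto
  have "g \<otimes> inv x \<otimes> inv g = inv (g \<otimes> x \<otimes> inv g)"
    using x g by (simp add: inv_mult_group m_assoc)
  then show ?case using generate_m_inv_closed[OF X step[OF inv]] by simp
next
  case (eng h k)
  then have "h \<in> carrier G" "k \<in> carrier G"
    using generate_in_carrier[OF X] by auto
  then show ?case using eng conj_mult[OF g] by (simp add: generate.eng)
qed (use step in auto)

end

section \<open>Lifts of adjacent transpositions\<close>

text \<open>A group with elements \<open>r\<^sub>1, \<dots>, r\<^bsub>n-1\<^esub>\<close> that satisfy the Coxeter relations of \<open>S\<^sub>n\<close> and lie over the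
  adjacent transpositions under a homomorphism \<open>\<phi>\<close> to \<open>S\<^sub>n\<close>. The aim is that \<open>\<phi>\<close> maps the subgroup that they
  generate bijectively to \<open>S\<^sub>n\<close>.\<close>

locale adjacent_transposition_lifts = group G for G (structure) +
  fixes n :: nat and r :: "nat \<Rightarrow> 'a" and \<phi> :: "'a \<Rightarrow> nat \<Rightarrow> nat"
  assumes r_closed: "i \<in> {1..<n} \<Longrightarrow> r i \<in> carrier G"
    and r_square: "i \<in> {1..<n} \<Longrightarrow> r i \<otimes> r i = \<one>"
    and r_braid: "1 \<le> i \<Longrightarrow> i + 2 \<le> n \<Longrightarrow> r i \<otimes> (r (Suc i) \<otimes> r i) = r (Suc i) \<otimes> (r i \<otimes> r (Suc i))"
    and r_far: "far n i j \<Longrightarrow> r i \<otimes> r j = r j \<otimes> r i"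
    and phi_hom: "\<phi> \<in> hom G (sym_group n)"
    and phi_r: "i \<in> {1..<n} \<Longrightarrow> \<phi> (r i) = transpose i (Suc i)"
begin

lemma inv_r: "i \<in> {1..<n} \<Longrightarrow> inv (r i) = r i"
  using r_closed r_square by (simp add: inv_equality)

lemma r_r_cancel: "i \<in> {1..<n} \<Longrightarrow> x \<in> carrier G \<Longrightarrow> r i \<otimes> (r i \<otimes> x) = x"
  using r_closed r_square by (simp add: m_assoc[symmetric])

interpretation phi: group_hom G "sym_group n" \<phi>
  using phi_hom by (simp add: group_hom_def group_hom_axioms_def sym_group_is_group is_group)

lemma phi_one: "\<phi> \<one> = id"
  using phi.hom_one by (simp add: sym_group_one)

lemma phi_mult: "x \<in> carrier G \<Longrightarrow> y \<in> carrier G \<Longrightarrow> \<phi> (x \<otimes> y) = \<phi> x \<circ> \<phi> y"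
  by (simp add: phi.hom_mult sym_group_mult)

lemma phi_permutes: "x \<in> carrier G \<Longrightarrow> \<phi> x permutes {1..n}"
  using phi.hom_closed sym_group_carrier by blast

lemma phi_inv: "x \<in> carrier G \<Longrightarrow> \<phi> (inv x) = inv' (\<phi> x)"
  by (simp add: phi.hom_inv phi.hom_closed)

declare sym_group_mult [simp] and sym_group_one [simp]

definition W :: "nat \<Rightarrow> 'a set" where "W k = generate G (r ` {k..<n})"

lemma r_image_carrier: "1 \<le> k \<Longrightarrow> r ` {k..<n} \<subseteq> carrier G"
  using r_closed by auto

lemma W_subgroup: "1 \<le> k \<Longrightarrow> subgroup (W k) G"
  unfolding W_def by (intro generate_is_subgroup r_image_carrier)

lemma W_carrier: "1 \<le> k \<Longrightarrow> w \<in> W k \<Longrightarrow> w \<in> carrier G"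
  using subgroup.mem_carrier[OF W_subgroup] .

lemma W_fixes: 
  assumes k: "1 \<le> k" and w: "w \<in> W k" and t: "t < k"
  shows "\<phi> w t = t"
proof -
  have "\<phi> w \<in> generate (sym_group n) (\<phi> ` r ` {k..<n})"
    using phi.generate_img[OF r_image_carrier[OF k]] w by (auto simp: W_def)
  then have "\<phi> w \<in> {p. p t = t}"
  proof (induction rule: generate.induct)
    case (inv h)
    then obtain i where i: "h = transpose i (Suc i)" "i \<in> {k..<n}"
      using phi_r k by auto
    then have "h \<in> carrier (sym_group n)"
      using k by (auto simp: sym_group_carrier intro!: permutes_swap_id)
    then show ?case using i t by simp
  qed (use phi_r k t in \<open>auto simp: sym_group_one sym_group_mult\<close>)
  then show ?thesis by simp
qed

text \<open>\<open>desc k m\<close> is the product \<open>r\<^bsub>k+m-1\<^esub> \<dots> r\<^bsub>k+1\<^esub> r\<^sub>k\<close>. Its permutation sends \<open>k\<close> to \<open>k + m\<close>, so these elements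
  are the expected representatives of the left cosets of \<open>W (k + 1)\<close> in \<open>W k\<close>.\<close>

primrec desc :: "nat \<Rightarrow> nat \<Rightarrow> 'a" where
  "desc k 0 = \<one>"
| "desc k (Suc m) = r (k + m) \<otimes> desc k m"

lemma desc_carrier: "1 \<le> k \<Longrightarrow> k + m \<le> n \<Longrightarrow> desc k m \<in> carrier G"
  by (induction m) (auto intro!: m_closed r_closed)

lemma phi_desc: "1 \<le> k \<Longrightarrow> k + m \<le> n \<Longrightarrow> \<phi> (desc k m) k = k + m"
  by (induction m) (auto simp: phi_one phi_mult phi_r r_closed desc_carrier)

lemma r_far_desc:
  assumes "1 \<le> k" "k + m < i" "i < n"
  shows "r i \<otimes> desc k m = desc k m \<otimes> r i"
  using assms
proof (induction m)
  case (Suc m)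
  have c: "r i \<in> carrier G" "r (k + m) \<in> carrier G" "desc k m \<in> carrier G"
    using Suc.prems by (auto intro: r_closed desc_carrier)
  have "r i \<otimes> r (k + m) = r (k + m) \<otimes> r i"
    using Suc.prems by (intro r_far) (auto simp: far_def)
  then show ?case using Suc c by (simp add: m_assoc) (metis m_assoc)
qed (use r_closed in auto)

text \<open>The factor \<open>r i\<close> passes the larger letters by commutation, the pair \<open>r\<^bsub>i+1\<^esub> r\<^sub>i\<close> by the braid relation,
  which turns it into \<open>r\<^bsub>i+1\<^esub>\<close>, and the smaller letters again by commutation.\<close>

lemma r_inside_desc:
  assumes "1 \<le> k" "k \<le> i" "Suc i < k + m" "k + m \<le> n"
  shows "r i \<otimes> desc k m = desc k m \<otimes> r (Suc i)"
  using assms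
proof (induction m)
  case (Suc m)
  have c: "r i \<in> carrier G" "r (Suc i) \<in> carrier G" "r (k + m) \<in> carrier G" "desc k m \<in> carrier G"
    using Suc.prems by (auto intro: r_closed desc_carrier)
  show ?case
  proof (cases "Suc i = k + m")
    case False
    have "r i \<otimes> r (k + m) = r (k + m) \<otimes> r i"
      using Suc.prems False by (intro r_far) (auto simp: far_def)
    then have "r i \<otimes> desc k (Suc m) = r (k + m) \<otimes> (r i \<otimes> desc k m)"
      using c by (simp add: m_assoc[symmetric])
    also have "\<dots> = desc k (Suc m) \<otimes> r (Suc i)"
      using Suc False c by (simp add: m_assoc)
    finally show ?thesis .
  next
    case True
    then obtain m' where m: "m = Suc m'" using Suc.prems by (cases m) auto
    have i: "i = k + m'" using True m by simp
    have c': "desc k m' \<in> carrier G" using Suc.prems m by (intro desc_carrier) auto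
    have "r i \<otimes> desc k (Suc m) = (r i \<otimes> (r (Suc i) \<otimes> r i)) \<otimes> desc k m'"
      using c c' by (simp add: m i m_assoc)
    also have "\<dots> = (r (Suc i) \<otimes> (r i \<otimes> r (Suc i))) \<otimes> desc k m'"
      using Suc.prems r_braid[of i] by simp
    also have "\<dots> = r (Suc i) \<otimes> (r i \<otimes> (r (Suc i) \<otimes> desc k m'))"
      using c c' by (simp add: m_assoc)
    also have "r (Suc i) \<otimes> desc k m' = desc k m' \<otimes> r (Suc i)"
      using Suc.prems i by (intro r_far_desc) auto
    also have "r (Suc i) \<otimes> (r i \<otimes> (desc k m' \<otimes> r (Suc i))) = desc k (Suc m) \<otimes> r (Suc i)"
      using c c' by (simp add: m i m_assoc)
    finally show ?thesis .
  qed
qed simp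

lemma r_desc_cases:
  assumes k: "1 \<le> k" "k \<le> i" "i < n" "k + m \<le> n"
  shows "\<exists>m' w. k + m' \<le> n \<and> w \<in> W (Suc k) \<and> r i \<otimes> desc k m = desc k m' \<otimes> w"
proof -
  have one: "\<one> \<in> W (Suc k)" by (simp add: W_def generate.one)
  have inc: "r j \<in> W (Suc k)" if "Suc k \<le> j" "j < n" for j
    using that by (auto simp: W_def intro: generate.incl)
  consider "i = k + m" | "k + m < i" | "Suc i = k + m" | "Suc i < k + m" by linarith
  then show ?thesis
  proof cases
    case 1
    then show ?thesis using one k desc_carrier[of k "Suc m"]
      by (intro exI[of _ "Suc m"] exI[of _ \<one>]) (auto intro: r_closed desc_carrier)
  next
    case 2
    then show ?thesis using inc k r_far_desc by (intro exI[of _ m] exI[of _ "r i"]) auto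
  next
    case 3
    then obtain m' where m: "m = Suc m'" "i = k + m'" using k by (cases m) auto
    then show ?thesis using one k desc_carrier[of k m'] r_r_cancel
      by (intro exI[of _ m'] exI[of _ \<one>]) auto
  next
    case 4
    then show ?thesis using inc k r_inside_desc
      by (intro exI[of _ m] exI[of _ "r (Suc i)"]) auto
  qed
qed

lemma W_decomp:
  assumes k: "1 \<le> k" "k \<le> n" and w: "w \<in> W k"
  shows "\<exists>m v. k + m \<le> n \<and> v \<in> W (Suc k) \<and> w = desc k m \<otimes> v"
proof -
  define U where "U = {desc k m \<otimes> v | m v. k + m \<le> n \<and> v \<in> W (Suc k)}"
  interpret W': subgroup "W (Suc k)" G by (rule W_subgroup) simp
  have U: "U \<subseteq> carrier G"
    using k W_carrier[of "Suc k"] by (auto simp: U_def simp del: W'.m_closed intro!: m_closed desc_carrier)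
  have "desc k 0 \<otimes> \<one> \<in> U" unfolding U_def using k(2) W'.one_closed by fastforce
  then have "\<one> \<in> U" by simp
  moreover have "r i \<otimes> u \<in> U" if i: "i \<in> {k..<n}" and u: "u \<in> U" for i u
  proof -
    obtain m v where mv: "k + m \<le> n" "v \<in> W (Suc k)" "u = desc k m \<otimes> v"
      using u by (auto simp: U_def)
    obtain m' v' where mv': "k + m' \<le> n" "v' \<in> W (Suc k)" "r i \<otimes> desc k m = desc k m' \<otimes> v'"
      using r_desc_cases[of k i m] k i mv(1) by auto
    have "r i \<otimes> u = (r i \<otimes> desc k m) \<otimes> v"
      using mv k i by (simp add: m_assoc r_closed desc_carrier)
    also have "\<dots> = desc k m' \<otimes> (v' \<otimes> v)"
      using mv mv' k by (simp add: m_assoc desc_carrier)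
    finally show ?thesis using mv' mv by (auto simp: U_def)
  qed
  ultimately have "w \<otimes> \<one> \<in> U"
    using w k U inv_r by (intro generate_left_closed[of "r ` {k..<n}"]) (auto simp: W_def r_closed)
  then have "w \<in> U" using W_carrier[OF k(1) w] by simp
  then show ?thesis by (auto simp: U_def)
qed

text \<open>By the normal form \<open>desc k m \<otimes> v\<close>, the value of the permutation at \<open>k\<close> is \<open>k + m\<close>, and it decides which
  coset \<open>w\<close> lies in. Applied repeatedly, this computes pointwise stabilisers of initial segments.\<close>

lemma W_stabilizer:
  assumes k: "1 \<le> k" "k \<le> n" and w: "w \<in> W k" and fix_k: "\<phi> w k = k"
  shows "w \<in> W (Suc k)"
proof -
  obtain m v where mv: "k + m \<le> n" "v \<in> W (Suc k)" "w = desc k m \<otimes> v"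
    using W_decomp[OF k w] by blast
  have v: "v \<in> carrier G" "\<phi> v k = k"
    using W_carrier[OF _ mv(2)] W_fixes[OF _ mv(2)] by auto
  have "\<phi> w k = k + m"
    using mv v k by (simp add: phi_mult desc_carrier phi_desc)
  then have "m = 0" using fix_k by simp
  then show ?thesis using mv v by simp
qed

text \<open>The Coxeter presentation of the symmetric group: the relations among the \<open>r i\<close> suffice to make \<open>\<phi>\<close>
  injective on the subgroup that they generate. A word with trivial permutation fixes \<open>1, 2, \<dots>, n\<close> in turn
  and so descends to \<open>W (n + 1)\<close>, which is trivial.\<close>

lemma W_trivial:
  assumes w: "w \<in> W 1" and "\<phi> w = id"
  shows "w = \<one>"
proof -
  have "Suc k \<le> n \<Longrightarrow> w \<in> W (Suc k)" for k
    using assms by (induction k) (auto intro: W_stabilizer)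
  then have "w \<in> W (max 1 n)"
    using w by (cases n) (auto simp: max_def)
  then have "w \<in> generate G {}" by (simp add: W_def)
  then show ?thesis by (simp add: generate_empty)
qed

lemma W_surj:
  assumes "p permutes {1..n}"
  shows "\<exists>w \<in> W 1. \<phi> w = p"
proof -
  interpret W: subgroup "W (Suc 0)" G by (rule W_subgroup) simp
  have tr: "\<exists>w \<in> W 1. \<phi> w = transpose a (Suc (a + d))" if "1 \<le> a" "Suc (a + d) \<le> n" for a d
    using that
  proof (induction d)
    case 0
    then have "r a \<in> W 1" by (auto simp: W_def intro: generate.incl)
    then show ?case using 0 by (intro bexI[of _ "r a"]) (auto simp: phi_r)
  next
    case (Suc d)
    then obtain w where w: "w \<in> W 1" "\<phi> w = transpose a (Suc (a + d))" by auto
    let ?i = "Suc (a + d)"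
    have r: "r ?i \<in> W 1" using Suc.prems by (auto simp: W_def intro: generate.incl)
    have "\<phi> (r ?i \<otimes> w \<otimes> r ?i) = transpose ?i (Suc ?i) \<circ> transpose a ?i \<circ> transpose ?i (Suc ?i)"
      using w r Suc.prems by (simp add: phi_mult phi_r W.mem_carrier)
    also have "\<dots> = transpose a (Suc (a + Suc d))"
      by (auto simp: fun_eq_iff transpose_def)
    finally show ?case using w r by (intro bexI[of _ "r ?i \<otimes> w \<otimes> r ?i"]) auto
  qed
  have tr': "\<exists>w \<in> W 1. \<phi> w = transpose a b" if "a \<in> {1..n}" "b \<in> {1..n}" "a < b" for a b
    using tr[of a "b - Suc a"] that by auto
  have "finite {1..n}" by simp
  with assms show ?thesis
  proof (induction p rule: permutes_induct)
    case id
    show ?case using phi_one by (intro bexI[of _ \<one>]) (simp_all add: id_def)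
  next
    case (swap a b p)
    then obtain w where w: "w \<in> W 1" "\<phi> w = p" by auto
    obtain v where v: "v \<in> W 1" "\<phi> v = transpose a b"
      using tr'[of a b] tr'[of b a] swap by (metis linorder_neqE_nat transpose_commute)
    show ?case
      using w v by (intro bexI[of _ "v \<otimes> w"]) (auto simp: phi_mult W.mem_carrier)
  qed
qed

lemma W_map_lists:
  assumes "distinct xs" "distinct ys" "length xs = length ys" "set xs \<subseteq> {1..n}" "set ys \<subseteq> {1..n}"
  shows "\<exists>w \<in> W 1. map (\<phi> w) xs = ys"
  using permutes_map_lists[OF assms] W_surj by blast

end

section \<open>The generators of the pure subgroup\<close>

text \<open>The facts about \<open>UVB\<^sub>n\<close> on which the structure of its pure subgroup rests, with \<open>s\<close> and \<open>r\<close> for the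
  families \<open>\<sigma>\<close> and \<open>\<rho>\<close>. The two conditions \<open>r_s_s\<close> and \<open>r_s_s'\<close> are the forbidden moves. Four strands make
  room for two disjoint pairs of indices.\<close>

locale unrestricted_virtual_braid_relations = adjacent_transposition_lifts G n r \<phi>
  for G (structure) and n r \<phi> +
  fixes s :: "nat \<Rightarrow> 'a"
  assumes four_le_n: "4 \<le> n"
    and s_closed: "i \<in> {1..<n} \<Longrightarrow> s i \<in> carrier G"
    and s_braid: "1 \<le> i \<Longrightarrow> i + 2 \<le> n \<Longrightarrow> s i \<otimes> (s (Suc i) \<otimes> s i) = s (Suc i) \<otimes> (s i \<otimes> s (Suc i))"
    and s_far: "far n i j \<Longrightarrow> s i \<otimes> s j = s j \<otimes> s i"
    and s_r_far: "far n i j \<Longrightarrow> s i \<otimes> r j = r j \<otimes> s i"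
    and s_r_r: "1 \<le> i \<Longrightarrow> i + 2 \<le> n \<Longrightarrow> s i \<otimes> (r (Suc i) \<otimes> r i) = r (Suc i) \<otimes> (r i \<otimes> s (Suc i))"
    and r_s_s: "1 \<le> i \<Longrightarrow> i + 2 \<le> n \<Longrightarrow> r i \<otimes> (s (Suc i) \<otimes> s i) = s (Suc i) \<otimes> (s i \<otimes> r (Suc i))"
    and r_s_s': "1 \<le> i \<Longrightarrow> i + 2 \<le> n \<Longrightarrow> r (Suc i) \<otimes> (s i \<otimes> s (Suc i)) = s i \<otimes> (s (Suc i) \<otimes> r i)"
    and phi_s: "i \<in> {1..<n} \<Longrightarrow> \<phi> (s i) = transpose i (Suc i)"
    and generators: "carrier G = generate G (s ` {1..<n} \<union> r ` {1..<n})"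
begin

text \<open>The generators \<open>\<lambda>\<^bsub>i,j\<^esub>\<close> of the pure group. The choice of the conjugating element is immaterial, by
  \<open>lam_eq\<close> below.\<close>

definition lam :: "nat \<Rightarrow> nat \<Rightarrow> 'a" where
  "lam i j = (let w = SOME w. w \<in> W 1 \<and> \<phi> w 1 = i \<and> \<phi> w 2 = j in w \<otimes> (s 1 \<otimes> r 1) \<otimes> inv w)"

lemma base_carrier: "s 1 \<otimes> r 1 \<in> carrier G"
  using four_le_n by (intro m_closed s_closed r_closed) auto

lemma W3_commutes:
  assumes "v \<in> W 3" shows "(s 1 \<otimes> r 1) \<otimes> v = v \<otimes> (s 1 \<otimes> r 1)"
proof (rule commute_generate[OF _ base_carrier])
  show "r ` {3..<n} \<subseteq> carrier G" by (rule r_image_carrier) simp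
  show "v \<in> generate G (r ` {3..<n})" using assms by (simp add: W_def)
  fix x assume "x \<in> r ` {3..<n}"
  then obtain i where i: "x = r i" "i \<in> {3..<n}" by auto
  then have far: "far n 1 i" by (auto simp: far_def)
  have c: "s 1 \<in> carrier G" "r 1 \<in> carrier G" "r i \<in> carrier G"
    using i four_le_n by (auto intro: s_closed r_closed)
  show "(s 1 \<otimes> r 1) \<otimes> x = x \<otimes> (s 1 \<otimes> r 1)"
    using r_far[OF far] s_r_far[OF far] c unfolding i(1) by (metis m_assoc)
qed

text \<open>Two candidates for the conjugating element differ by an element of \<open>W 1\<close> whose permutation fixes \<open>1\<close> and
  \<open>2\<close>. Such an element lies in \<open>W 3\<close>, and \<open>r\<^sub>3, \<dots>, r\<^bsub>n-1\<^esub>\<close> commute with both \<open>s\<^sub>1\<close> and \<open>r\<^sub>1\<close>.\<close>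

lemma lam_eq:
  assumes w: "w \<in> W 1" "\<phi> w 1 = i" "\<phi> w 2 = j"
  shows "lam i j = w \<otimes> (s 1 \<otimes> r 1) \<otimes> inv w"
proof -
  interpret W: subgroup "W 1" G by (rule W_subgroup) simp
  define u where "u = (SOME w. w \<in> W 1 \<and> \<phi> w 1 = i \<and> \<phi> w 2 = j)"
  have "u \<in> W 1 \<and> \<phi> u 1 = i \<and> \<phi> u 2 = j"
    unfolding u_def
    by (rule someI[of "\<lambda>w. w \<in> W 1 \<and> \<phi> w 1 = i \<and> \<phi> w 2 = j" w]) (use w in blast)
  then have u: "u \<in> W 1" "\<phi> u 1 = i" "\<phi> u 2 = j" by auto
  have c: "u \<in> carrier G" "w \<in> carrier G" using u w W.mem_carrier by auto
  define v where "v = inv u \<otimes> w"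
  have v: "v \<in> W 1" unfolding v_def using u(1) w(1) W.m_closed W.m_inv_closed by blast
  have "\<phi> v t = t" if "\<phi> u t = \<phi> w t" for t
    using permutes_inverses(2)[OF phi_permutes[OF c(1)], of t] that c
    by (simp add: v_def phi_mult phi_inv)
  then have fixes_12: "\<phi> v 1 = 1" "\<phi> v 2 = 2" using u w by auto
  have "v \<in> W (Suc 1)" using four_le_n v fixes_12(1) by (intro W_stabilizer) auto
  then have "v \<in> W (Suc 2)" using four_le_n fixes_12(2) by (intro W_stabilizer) (auto simp: numeral_2_eq_2)
  then have "v \<in> W 3" by (simp add: numeral_3_eq_3 numeral_2_eq_2)
  moreover have vc: "v \<in> carrier G" using v W.mem_carrier by auto
  ultimately have fix_base: "v \<otimes> (s 1 \<otimes> r 1) \<otimes> inv v = s 1 \<otimes> r 1"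
    using conj_of_commuting[OF vc base_carrier] W3_commutes[of v] by simp
  have "w = u \<otimes> v" using c by (simp add: v_def m_assoc[symmetric])
  then have "w \<otimes> (s 1 \<otimes> r 1) \<otimes> inv w = u \<otimes> (s 1 \<otimes> r 1) \<otimes> inv u"
    using conj_conj[OF c(1) vc base_carrier] fix_base by simp
  then show ?thesis by (simp add: lam_def u_def Let_def)
qed

definition ordered_pairs :: "(nat \<times> nat) set" where
  "ordered_pairs = {(i, j). i \<in> {1..n} \<and> j \<in> {1..n} \<and> i \<noteq> j}"

lemma ordered_pairs_conj:
  assumes "(i, j) \<in> ordered_pairs"
  obtains w where "w \<in> W 1" "w \<in> carrier G" "\<phi> w 1 = i" "\<phi> w 2 = j"
    "lam i j = w \<otimes> (s 1 \<otimes> r 1) \<otimes> inv w"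
proof -
  have "\<exists>w \<in> W 1. map (\<phi> w) [1, 2] = [i, j]"
    using assms four_le_n by (intro W_map_lists) (auto simp: ordered_pairs_def)
  then obtain w where "w \<in> W 1" "\<phi> w 1 = i" "\<phi> w 2 = j" by auto
  then show thesis using that W_carrier[of 1 w] lam_eq by simp
qed

lemma lam_carrier: "(i, j) \<in> ordered_pairs \<Longrightarrow> lam i j \<in> carrier G"
  using ordered_pairs_conj base_carrier by (metis inv_closed m_closed)

lemma lam_conj:
  assumes w: "w \<in> W 1" and p: "(i, j) \<in> ordered_pairs"
  shows "w \<otimes> lam i j \<otimes> inv w = lam (\<phi> w i) (\<phi> w j)"
proof -
  interpret W: subgroup "W 1" G by (rule W_subgroup) simp
  obtain u where u: "u \<in> W 1" "u \<in> carrier G" "\<phi> u 1 = i" "\<phi> u 2 = j"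
    "lam i j = u \<otimes> (s 1 \<otimes> r 1) \<otimes> inv u"
    using ordered_pairs_conj[OF p] by blast
  have wc: "w \<in> carrier G" using w W.mem_carrier by auto
  have "w \<otimes> lam i j \<otimes> inv w = (w \<otimes> u) \<otimes> (s 1 \<otimes> r 1) \<otimes> inv (w \<otimes> u)"
    using u(5) conj_conj[OF wc u(2) base_carrier] by simp
  also have "\<dots> = lam (\<phi> w i) (\<phi> w j)"
    using u wc W.m_closed[OF w u(1)] by (intro lam_eq[symmetric]) (auto simp: phi_mult)
  finally show ?thesis .
qed

lemma phi_preserves_ordered_pairs:
  assumes "w \<in> carrier G" "(i, j) \<in> ordered_pairs"
  shows "(\<phi> w i, \<phi> w j) \<in> ordered_pairs"
  using assms permutes_in_image[OF phi_permutes[OF assms(1)]]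
    inj_eq[OF permutes_inj[OF phi_permutes[OF assms(1)]]]
  by (auto simp: ordered_pairs_def simp del: atLeastAtMost_iff)

lemma r_lam:
  assumes i: "i \<in> {1..<n}" and p: "(a, b) \<in> ordered_pairs"
  shows "r i \<otimes> lam a b = lam (transpose i (Suc i) a) (transpose i (Suc i) b) \<otimes> r i"
proof -
  have "r i \<in> W 1" using i by (auto simp: W_def intro: generate.incl)
  then have "r i \<otimes> lam a b \<otimes> r i = lam (transpose i (Suc i) a) (transpose i (Suc i) b)"
    using lam_conj[of "r i" a b] p i by (simp add: inv_r phi_r)
  then have "lam (transpose i (Suc i) a) (transpose i (Suc i) b) \<otimes> r i = r i \<otimes> lam a b \<otimes> r i \<otimes> r i"
    by simp
  also have "\<dots> = r i \<otimes> lam a b"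
    using i p r_closed r_square by (simp add: m_assoc lam_carrier)
  finally show ?thesis by simp
qed

text \<open>The mixed relation expresses \<open>s\<^bsub>i+1\<^esub>\<close> as a conjugate of \<open>s\<^sub>i\<close>, so the formula, which holds for \<open>i = 1\<close>
  by definition, propagates.\<close>

lemma s_as_lam:
  assumes "1 \<le> i" "i < n" shows "s i = lam i (Suc i) \<otimes> r i"
  using assms
proof (induction i rule: nat_induct_at_least)
  case base
  have "lam 1 2 = \<one> \<otimes> (s 1 \<otimes> r 1) \<otimes> inv \<one>"
    by (intro lam_eq) (auto simp: phi_one W_def generate.one)
  then have "lam 1 2 = s 1 \<otimes> r 1" using base_carrier by simp
  then have "lam 1 2 \<otimes> r 1 = s 1"
    using r_square[of 1] r_closed[of 1] s_closed[of 1] four_le_n by (simp add: m_assoc)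
  then show ?case by (simp add: numeral_2_eq_2)
next
  case (Suc i)
  have c: "r i \<in> carrier G" "r (Suc i) \<in> carrier G" "s i \<in> carrier G" "s (Suc i) \<in> carrier G"
    "lam i (Suc i) \<in> carrier G" "lam i (Suc (Suc i)) \<in> carrier G"
    "lam (Suc i) (Suc (Suc i)) \<in> carrier G"
    using Suc by (auto intro!: r_closed s_closed lam_carrier simp: ordered_pairs_def)
  have "r (Suc i) \<otimes> (r i \<otimes> s (Suc i)) = lam i (Suc i) \<otimes> (r i \<otimes> (r (Suc i) \<otimes> r i))"
    using s_r_r[of i] Suc c by (simp add: m_assoc)
  also have "\<dots> = lam i (Suc i) \<otimes> (r (Suc i) \<otimes> (r i \<otimes> r (Suc i)))"
    using r_braid[of i] Suc by simp
  finally have "r i \<otimes> (r (Suc i) \<otimes> (r (Suc i) \<otimes> (r i \<otimes> s (Suc i)))) =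
      r i \<otimes> (r (Suc i) \<otimes> (lam i (Suc i) \<otimes> (r (Suc i) \<otimes> (r i \<otimes> r (Suc i)))))"
    by simp
  then have "s (Suc i) = r i \<otimes> (r (Suc i) \<otimes> (lam i (Suc i) \<otimes> (r (Suc i) \<otimes> (r i \<otimes> r (Suc i)))))"
    using c r_r_cancel Suc by simp
  also have "\<dots> = r i \<otimes> ((r (Suc i) \<otimes> lam i (Suc i)) \<otimes> (r (Suc i) \<otimes> (r i \<otimes> r (Suc i))))"
    using c by (simp add: m_assoc)
  also have "r (Suc i) \<otimes> lam i (Suc i) = lam i (Suc (Suc i)) \<otimes> r (Suc i)"
    using r_lam[of "Suc i" i "Suc i"] Suc by (auto simp: ordered_pairs_def)
  also have "r i \<otimes> (lam i (Suc (Suc i)) \<otimes> r (Suc i) \<otimes> (r (Suc i) \<otimes> (r i \<otimes> r (Suc i)))) =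
      (r i \<otimes> lam i (Suc (Suc i))) \<otimes> (r i \<otimes> r (Suc i))"
    using c r_r_cancel Suc by (simp add: m_assoc)
  also have "r i \<otimes> lam i (Suc (Suc i)) = lam (Suc i) (Suc (Suc i)) \<otimes> r i"
    using r_lam[of i i "Suc (Suc i)"] Suc by (auto simp: ordered_pairs_def)
  also have "lam (Suc i) (Suc (Suc i)) \<otimes> r i \<otimes> (r i \<otimes> r (Suc i)) = lam (Suc i) (Suc (Suc i)) \<otimes> r (Suc i)"
    using c r_r_cancel Suc by (simp add: m_assoc)
  finally show ?case .
qed

lemma lam_commute_transfer:
  assumes comm: "lam a b \<otimes> lam c d = lam c d \<otimes> lam a b"
    and p: "(a, b) \<in> ordered_pairs" "(c, d) \<in> ordered_pairs" and w: "w \<in> W 1"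
  shows "lam (\<phi> w a) (\<phi> w b) \<otimes> lam (\<phi> w c) (\<phi> w d) = lam (\<phi> w c) (\<phi> w d) \<otimes> lam (\<phi> w a) (\<phi> w b)"
proof -
  have wc: "w \<in> carrier G" using W_carrier[of 1 w] w by simp
  show ?thesis
    using conj_mult[OF wc lam_carrier[OF p(1)] lam_carrier[OF p(2)]]
      conj_mult[OF wc lam_carrier[OF p(2)] lam_carrier[OF p(1)]] comm lam_conj[OF w] p by simp
qed

text \<open>After substituting \<open>s\<^sub>i = \<lambda>\<^bsub>i,i+1\<^esub> r\<^sub>i\<close> and moving every \<open>r\<close> to the right, both sides of a relation end in
  the same word in the \<open>r\<close>'s, which cancels. The two forbidden moves give the first two commutations, the
  braid relation among the \<open>s\<close>'s then gives the third, and \<open>s\<^sub>1 s\<^sub>3 = s\<^sub>3 s\<^sub>1\<close> gives the last.\<close>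

lemma lam_base_commute:
  shows "lam 1 2 \<otimes> lam 1 3 = lam 1 3 \<otimes> lam 1 2" (is ?A)
    and "lam 1 3 \<otimes> lam 2 3 = lam 2 3 \<otimes> lam 1 3" (is ?B)
    and "lam 1 2 \<otimes> lam 2 3 = lam 2 3 \<otimes> lam 1 2" (is ?C)
    and "lam 1 2 \<otimes> lam 3 4 = lam 3 4 \<otimes> lam 1 2" (is ?D)
proof -
  have p: "(1, 2) \<in> ordered_pairs" "(1, 3) \<in> ordered_pairs" "(2, 3) \<in> ordered_pairs"
    "(3, 4) \<in> ordered_pairs"
    using four_le_n by (auto simp: ordered_pairs_def)
  have lc: "lam 1 2 \<in> carrier G" "lam 1 3 \<in> carrier G" "lam 2 3 \<in> carrier G" "lam 3 4 \<in> carrier G"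
    using p by (auto intro: lam_carrier)
  have rc: "r 1 \<in> carrier G" "r 2 \<in> carrier G" "r 3 \<in> carrier G"
    using four_le_n by (auto intro: r_closed)
  have s: "s 1 = lam 1 2 \<otimes> r 1" "s 2 = lam 2 3 \<otimes> r 2" "s 3 = lam 3 4 \<otimes> r 3"
    using s_as_lam[of 1] s_as_lam[of 2] s_as_lam[of 3] four_le_n by (simp_all add: numeral_eq_Suc)
  have slide: "r 1 \<otimes> lam 1 3 = lam 2 3 \<otimes> r 1" "r 1 \<otimes> lam 2 3 = lam 1 3 \<otimes> r 1"
    "r 2 \<otimes> lam 1 2 = lam 1 3 \<otimes> r 2" "r 2 \<otimes> lam 1 3 = lam 1 2 \<otimes> r 2"
    "r 1 \<otimes> lam 3 4 = lam 3 4 \<otimes> r 1" "r 3 \<otimes> lam 1 2 = lam 1 2 \<otimes> r 3"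
    using r_lam[of 1 1 3] r_lam[of 1 2 3] r_lam[of 2 1 2] r_lam[of 2 1 3] r_lam[of 1 3 4]
      r_lam[of 3 1 2] p four_le_n by (simp_all add: transpose_def numeral_eq_Suc)
  have slide': "r 1 \<otimes> (lam 1 3 \<otimes> x) = lam 2 3 \<otimes> (r 1 \<otimes> x)"
    "r 1 \<otimes> (lam 2 3 \<otimes> x) = lam 1 3 \<otimes> (r 1 \<otimes> x)"
    "r 2 \<otimes> (lam 1 2 \<otimes> x) = lam 1 3 \<otimes> (r 2 \<otimes> x)"
    "r 2 \<otimes> (lam 1 3 \<otimes> x) = lam 1 2 \<otimes> (r 2 \<otimes> x)"
    "r 1 \<otimes> (lam 3 4 \<otimes> x) = lam 3 4 \<otimes> (r 1 \<otimes> x)"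
    "r 3 \<otimes> (lam 1 2 \<otimes> x) = lam 1 2 \<otimes> (r 3 \<otimes> x)" if "x \<in> carrier G" for x
    using slide lc rc that by (simp_all add: m_assoc[symmetric])
  have braid: "r 1 \<otimes> (r 2 \<otimes> r 1) = r 2 \<otimes> (r 1 \<otimes> r 2)"
    using r_braid[of 1] four_le_n by (simp add: numeral_2_eq_2)
  have cancel: "x = y" if "x \<otimes> z = y \<otimes> z" "x \<in> carrier G" "y \<in> carrier G" "z \<in> carrier G" for x y z
    using that right_cancel by blast
  let ?w = "r 2 \<otimes> (r 1 \<otimes> r 2)"
  have "r 2 \<otimes> (s 1 \<otimes> s 2) = s 1 \<otimes> (s 2 \<otimes> r 1)"
    using r_s_s'[of 1] four_le_n by (simp add: numeral_2_eq_2)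
  then have "(lam 1 3 \<otimes> lam 1 2) \<otimes> ?w = (lam 1 2 \<otimes> lam 1 3) \<otimes> ?w"
    using lc rc by (simp add: s m_assoc slide' braid del: One_nat_def)
  then have "lam 1 3 \<otimes> lam 1 2 = lam 1 2 \<otimes> lam 1 3"
    by (rule cancel) (use lc rc in auto)
  then show A: ?A by (rule HOL.sym)
  have "r 1 \<otimes> (s 2 \<otimes> s 1) = s 2 \<otimes> (s 1 \<otimes> r 2)"
    using r_s_s[of 1] four_le_n by (simp add: numeral_2_eq_2)
  then have "(lam 1 3 \<otimes> lam 2 3) \<otimes> ?w = (lam 2 3 \<otimes> lam 1 3) \<otimes> ?w"
    using lc rc by (simp add: s m_assoc slide' braid del: One_nat_def)
  then show B: ?B by (rule cancel) (use lc rc in auto)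
  have "s 1 \<otimes> (s 2 \<otimes> s 1) = s 2 \<otimes> (s 1 \<otimes> s 2)"
    using s_braid[of 1] four_le_n by (simp add: numeral_2_eq_2)
  then have "(lam 1 2 \<otimes> (lam 1 3 \<otimes> lam 2 3)) \<otimes> ?w = (lam 2 3 \<otimes> (lam 1 3 \<otimes> lam 1 2)) \<otimes> ?w"
    using lc rc by (simp add: s m_assoc slide' braid del: One_nat_def)
  then have "lam 1 2 \<otimes> (lam 1 3 \<otimes> lam 2 3) = lam 2 3 \<otimes> (lam 1 3 \<otimes> lam 1 2)"
    by (rule cancel) (use lc rc in auto)
  then have "(lam 1 3 \<otimes> (lam 1 2 \<otimes> lam 2 3)) = lam 1 3 \<otimes> (lam 2 3 \<otimes> lam 1 2)"
    using A B lc by (metis m_assoc)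
  then show ?C using lc by simp
  have far: "far n 1 3" using four_le_n by (auto simp: far_def)
  have "(lam 1 2 \<otimes> lam 3 4) \<otimes> (r 1 \<otimes> r 3) = (lam 3 4 \<otimes> lam 1 2) \<otimes> (r 1 \<otimes> r 3)"
    using s_far[OF far] r_far[OF far] lc rc by (simp add: s m_assoc slide' del: One_nat_def)
  then show ?D by (rule cancel) (use lc rc in auto)
qed

text \<open>Conjugation by \<open>W 1\<close> carries the four base cases to all configurations of two different unordered pairs:
  a common first index, a common second index, an index in both roles, or disjoint pairs.\<close>

lemma lam_commute:
  assumes p: "(i, j) \<in> ordered_pairs" "(k, l) \<in> ordered_pairs" and ne: "{i, j} \<noteq> {k, l}"
  shows "lam i j \<otimes> lam k l = lam k l \<otimes> lam i j"
proof -
  have q: "(1, 2) \<in> ordered_pairs" "(1, 3) \<in> ordered_pairs" "(2, 3) \<in> ordered_pairs"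
    "(3, 4) \<in> ordered_pairs"
    using four_le_n by (auto simp: ordered_pairs_def)
  have three: "lam x y \<otimes> lam x z = lam x z \<otimes> lam x y \<and> lam x z \<otimes> lam y z = lam y z \<otimes> lam x z \<and>
      lam x y \<otimes> lam y z = lam y z \<otimes> lam x y"
    if "distinct [x, y, z]" "set [x, y, z] \<subseteq> {1..n}" for x y z
  proof -
    have "\<exists>w \<in> W 1. map (\<phi> w) [1, 2, 3] = [x, y, z]"
      using that four_le_n by (intro W_map_lists) auto
    then obtain w where w: "w \<in> W 1" "\<phi> w 1 = x" "\<phi> w 2 = y" "\<phi> w 3 = z" by auto
    show ?thesis
      using lam_commute_transfer[OF lam_base_commute(1) q(1,2) w(1)]
        lam_commute_transfer[OF lam_base_commute(2) q(2,3) w(1)]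
        lam_commute_transfer[OF lam_base_commute(3) q(1,3) w(1)] w(2-4) by metis
  qed
  have four: "lam x y \<otimes> lam z t = lam z t \<otimes> lam x y"
    if "distinct [x, y, z, t]" "set [x, y, z, t] \<subseteq> {1..n}" for x y z t
  proof -
    have "\<exists>w \<in> W 1. map (\<phi> w) [1, 2, 3, 4] = [x, y, z, t]"
      using that four_le_n by (intro W_map_lists) auto
    then obtain w where w: "w \<in> W 1" "\<phi> w 1 = x" "\<phi> w 2 = y" "\<phi> w 3 = z" "\<phi> w 4 = t" by auto
    show ?thesis
      using lam_commute_transfer[OF lam_base_commute(4) q(1,4) w(1)] w(2-5) by metis
  qed
  have ij: "i \<in> {1..n}" "j \<in> {1..n}" "k \<in> {1..n}" "l \<in> {1..n}" "i \<noteq> j" "k \<noteq> l"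
    using p by (auto simp: ordered_pairs_def)
  consider "i = k" "j \<noteq> l" | "j = l" "i \<noteq> k" | "j = k" "i \<noteq> l" | "i = l" "j \<noteq> k"
    | "distinct [i, j, k, l]"
    using ij ne by auto
  then show ?thesis
  proof cases
    case 1
    then show ?thesis using three[of i j l] ij by auto
  next
    case 2
    then show ?thesis using three[of i k j] ij by auto
  next
    case 3
    then show ?thesis using three[of i j l] ij by auto
  next
    case 4
    then show ?thesis using three[of k i j] ij by auto
  next
    case 5
    then show ?thesis using four[of i j k l] ij by auto
  qed
qed

definition P :: "'a set" where "P = generate G (case_prod lam ` ordered_pairs)"

lemma lams_carrier: "case_prod lam ` A \<subseteq> carrier G" if "A \<subseteq> ordered_pairs"
  using that lam_carrier by auto

lemma P_subgroup: "subgroup P G"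
  unfolding P_def by (intro generate_is_subgroup lams_carrier) simp

text \<open>\<open>P\<close> is normalised by \<open>W 1\<close>, which permutes the \<open>\<lambda>\<close>'s; and \<open>s\<^sub>i\<close> and \<open>r\<^sub>i\<close> agree up to an element of \<open>P\<close>.
  So the product set absorbs left multiplication by the generators.\<close>

lemma carrier_eq_P_W: "carrier G = P <#> W 1"
proof
  interpret P: subgroup P G by (rule P_subgroup)
  interpret W: subgroup "W (Suc 0)" G by (rule W_subgroup) simp
  show "P <#> W 1 \<subseteq> carrier G" using set_mult_closed[OF P.subset W.subset] by simp
  have lamP: "lam a b \<in> P" if "(a, b) \<in> ordered_pairs" for a b
    using that by (force simp: P_def intro: generate.incl)
  have rW: "r i \<in> W (Suc 0)" if "i \<in> {1..<n}" for i
    using that by (auto simp: W_def intro: generate.incl)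
  have rstep: "r i \<otimes> u \<in> P <#> W (Suc 0)" if i: "i \<in> {1..<n}" and u: "u \<in> P <#> W (Suc 0)" for i u
  proof -
    obtain p w where pw: "p \<in> P" "w \<in> W (Suc 0)" "u = p \<otimes> w" using u by (auto simp: set_mult_def)
    have rc: "r i \<in> carrier G" using r_closed i by auto
    have "r i \<otimes> p \<otimes> inv (r i) \<in> P"
      unfolding P_def
    proof (rule generate_conj_closed[OF lams_carrier rc])
      show "p \<in> generate G (case_prod lam ` ordered_pairs)" using pw(1) by (simp add: P_def)
      fix x assume "x \<in> case_prod lam ` ordered_pairs"
      then obtain a b where ab: "(a, b) \<in> ordered_pairs" "x = lam a b" by auto
      then have "r i \<otimes> x \<otimes> inv (r i) = lam (\<phi> (r i) a) (\<phi> (r i) b)"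
        using lam_conj[of "r i"] rW[OF i] by simp
      then show "r i \<otimes> x \<otimes> inv (r i) \<in> generate G (case_prod lam ` ordered_pairs)"
        using lamP[OF phi_preserves_ordered_pairs[OF rc ab(1)]] by (simp add: P_def)
    qed simp
    moreover have "r i \<otimes> u = (r i \<otimes> p \<otimes> inv (r i)) \<otimes> (r i \<otimes> w)"
      using pw rc by (simp add: conj_mult[symmetric] m_assoc) (simp add: m_assoc[symmetric])
    moreover have "r i \<otimes> w \<in> W (Suc 0)" using rW[OF i] pw by simp
    ultimately show ?thesis by (auto simp: set_mult_def)
  qed
  have Pstep: "p \<otimes> u \<in> P <#> W (Suc 0)" if p: "p \<in> P" and u: "u \<in> P <#> W (Suc 0)" for p u
  proof -
    obtain q w where "q \<in> P" "w \<in> W (Suc 0)" "u = q \<otimes> w" using u by (auto simp: set_mult_def)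
    moreover from this have "p \<otimes> u = (p \<otimes> q) \<otimes> w" using p by (simp add: m_assoc)
    ultimately show ?thesis using p by (auto simp: set_mult_def)
  qed
  have step: "x \<otimes> u \<in> P <#> W (Suc 0) \<and> inv x \<otimes> u \<in> P <#> W (Suc 0)"
    if x: "x \<in> s ` {1..<n} \<union> r ` {1..<n}" and u: "u \<in> P <#> W (Suc 0)" for x u
  proof -
    have uc: "u \<in> carrier G" using u set_mult_closed[OF P.subset W.subset] by auto
    obtain i where i: "i \<in> {1..<n}" "x = s i \<or> x = r i" using x by auto
    have c: "r i \<in> carrier G" using r_closed i by auto
    have l: "lam i (Suc i) \<in> P" using i by (intro lamP) (auto simp: ordered_pairs_def)
    have si: "s i = lam i (Suc i) \<otimes> r i" using s_as_lam[of i] i by auto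
    have "s i \<otimes> u = lam i (Suc i) \<otimes> (r i \<otimes> u)"
      using c l uc si by (simp add: m_assoc)
    moreover have "inv (s i) \<otimes> u = r i \<otimes> (inv (lam i (Suc i)) \<otimes> u)"
      using c l uc si i by (simp add: inv_mult_group inv_r m_assoc)
    ultimately show ?thesis
      using i rstep[OF i(1)] inv_r[OF i(1)] Pstep[OF l] Pstep[OF P.m_inv_closed[OF l]] u by auto
  qed
  show "carrier G \<subseteq> P <#> W 1"
  proof
    fix g assume g: "g \<in> carrier G"
    have "\<one> \<otimes> \<one> \<in> P <#> W (Suc 0)"
      unfolding set_mult_def using P.one_closed W.one_closed by blast
    moreover have "s ` {1..<n} \<union> r ` {1..<n} \<subseteq> carrier G" using s_closed r_closed by auto
    ultimately have "g \<otimes> \<one> \<in> P <#> W (Suc 0)"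
      using g generators set_mult_closed[OF P.subset W.subset] step
      by (intro generate_left_closed[of "s ` {1..<n} \<union> r ` {1..<n}"]) auto
    then show "g \<in> P <#> W 1" using g by simp
  qed
qed

lemma phi_P: assumes "p \<in> P" shows "\<phi> p = id"
proof -
  interpret phi: group_hom G "sym_group n" \<phi>
    using phi_hom by (simp add: group_hom_def group_hom_axioms_def sym_group_is_group is_group)
  have sub: "subgroup (kernel G (sym_group n) \<phi>) G" by (rule phi.subgroup_kernel)
  have "lam i j \<in> kernel G (sym_group n) \<phi>" if ij: "(i, j) \<in> ordered_pairs" for i j
  proof -
    obtain w where w: "w \<in> carrier G" "lam i j = w \<otimes> (s 1 \<otimes> r 1) \<otimes> inv w"
      using ordered_pairs_conj[OF ij] by blast
    have c: "s 1 \<in> carrier G" "r 1 \<in> carrier G" using s_closed r_closed four_le_n by auto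
    have "\<phi> (s 1 \<otimes> r 1) = id"
      using c four_le_n by (simp only: phi_mult) (simp add: phi_s phi_r)
    then have "\<phi> (lam i j) = \<phi> w \<circ> inv' (\<phi> w)"
      using w base_carrier phi_inv[OF w(1)] by (simp add: phi_mult del: phi.hom_mult One_nat_def)
    then show ?thesis
      using permutes_inv_o(1)[OF phi_permutes[OF w(1)]] lam_carrier[OF ij]
      by (simp add: kernel_def sym_group_one)
  qed
  then have "P \<subseteq> kernel G (sym_group n) \<phi>"
    unfolding P_def by (intro generate_subgroup_incl[OF _ sub]) auto
  then show ?thesis using assms by (auto simp: kernel_def sym_group_one)
qed

lemma kernel_eq_P: "kernel G (sym_group n) \<phi> = P"
proof
  interpret P: subgroup P G by (rule P_subgroup)
  show "P \<subseteq> kernel G (sym_group n) \<phi>"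
    using phi_P by (auto simp: kernel_def sym_group_one)
  show "kernel G (sym_group n) \<phi> \<subseteq> P"
  proof
    fix g assume "g \<in> kernel G (sym_group n) \<phi>"
    then have g: "g \<in> carrier G" "\<phi> g = id" by (auto simp: kernel_def sym_group_one)
    then obtain p w where pw: "p \<in> P" "w \<in> W 1" "g = p \<otimes> w"
      using carrier_eq_P_W by (auto simp: set_mult_def)
    have "\<phi> w = id"
      using g(2) pw phi_P[OF pw(1)] W_carrier[OF _ pw(2)] by (simp add: phi_mult)
    then have "w = \<one>" using W_trivial pw(2) by blast
    then show "g \<in> P" using pw by simp
  qed
qed

lemma P_normal: "P \<lhd> G"
proof -
  interpret phi: group_hom G "sym_group n" \<phi>
    using phi_hom by (simp add: group_hom_def group_hom_axioms_def sym_group_is_group is_group)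
  show ?thesis using phi.normal_kernel by (simp add: kernel_eq_P)
qed

text \<open>\<open>P\<close> is the product of the subgroups generated by the \<open>\<lambda>\<close>'s inside and outside \<open>E\<close>. By commutation and
  normality, \<open>\<psi>\<close> must kill one of them, hence some \<open>\<lambda>\<^bsub>i,j\<^esub>\<close>, hence \<open>s\<^sub>1 r\<^sub>1\<close> and all its conjugates.\<close>

theorem surjective_hom_trivial_on_P:
  assumes n: "n \<ge> 5" and hom: "\<psi> \<in> hom G (sym_group n)"
    and surj: "\<psi> ` carrier G = carrier (sym_group n)"
    and p: "p \<in> P"
  shows "\<psi> p = id"
proof -
  interpret psi: group_hom G "sym_group n" \<psi>
    using hom by (simp add: group_hom_def group_hom_axioms_def sym_group_is_group is_group)
  \<comment> \<open>\<open>E\<close> consists of the two orderings of \<open>{1, 2}\<close>; any other index pair is a different unordered pair.\<close>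
  define E where "E = {(1 :: nat, 2 :: nat), (2, 1)}"
  define F where "F = ordered_pairs - E"
  have sub: "E \<subseteq> ordered_pairs" "F \<subseteq> ordered_pairs" "E \<union> F = ordered_pairs"
    using four_le_n by (auto simp: E_def F_def ordered_pairs_def)
  let ?A = "generate G (case_prod lam ` E)" and ?B = "generate G (case_prod lam ` F)"
  have comm: "x \<otimes> y = y \<otimes> x" if "x \<in> case_prod lam ` E" "y \<in> case_prod lam ` F" for x y
  proof -
    obtain i j k l where ij: "(i, j) \<in> E" "x = lam i j" and kl: "(k, l) \<in> F" "y = lam k l"
      using \<open>x \<in> _\<close> \<open>y \<in> _\<close> by auto
    have "{i, j} \<noteq> {k, l}" using ij kl by (auto simp: E_def F_def doubleton_eq_iff)
    then show ?thesis using lam_commute ij kl sub by blast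
  qed
  note gens = lams_carrier[OF sub(1)] lams_carrier[OF sub(2)]
  have P: "P = ?A <#> ?B"
    using generate_Un_commuting[OF gens comm] sub(3) by (simp add: P_def image_Un[symmetric])
  have img: "\<psi> ` P = \<psi> ` ?A <#>\<^bsub>sym_group n\<^esub> \<psi> ` ?B"
  proof -
    have "\<psi> (a \<otimes> b) = \<psi> a \<otimes>\<^bsub>sym_group n\<^esub> \<psi> b" if "a \<in> ?A" "b \<in> ?B" for a b
      using that generate_in_carrier gens by (intro psi.hom_mult) blast+
    then show ?thesis unfolding P set_mult_def by (auto simp: image_iff) (metis (no_types))+
  qed
  have "\<psi> ` P \<lhd> sym_group n"
    using normal.surj_hom_normal_subgroup[OF P_normal psi.group_hom_axioms surj] .
  moreover have "\<psi> a \<circ> \<psi> b = \<psi> b \<circ> \<psi> a" if "a \<in> ?A" "b \<in> ?B" for a b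
    using generates_commute[OF gens comm that] psi.hom_mult that generate_in_carrier gens
    by (metis sym_group_mult)
  ultimately have "\<psi> ` ?A = {id} \<or> \<psi> ` ?B = {id}"
    unfolding img
    by (intro commuting_factors_of_normal_subgroup_sym[OF n] psi.subgroup_img_is_subgroup
        generate_is_subgroup gens) auto
  moreover have "lam 1 2 \<in> ?A" "lam 1 3 \<in> ?B"
    using four_le_n by (force simp: E_def F_def ordered_pairs_def intro: generate.incl)+
  moreover have "(1, 2) \<in> ordered_pairs" "(1, 3) \<in> ordered_pairs"
    using four_le_n by (auto simp: ordered_pairs_def)
  ultimately obtain i j where ij: "(i, j) \<in> ordered_pairs" "\<psi> (lam i j) = id"
    by (metis imageI singletonD)
  interpret K: normal "kernel G (sym_group n) \<psi>" G by (rule psi.normal_kernel)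
  have base: "s 1 \<otimes> r 1 \<in> kernel G (sym_group n) \<psi>"
  proof -
    obtain w where w: "w \<in> carrier G" "lam i j = w \<otimes> (s 1 \<otimes> r 1) \<otimes> inv w"
      using ordered_pairs_conj[OF ij(1)] by blast
    have "lam i j \<in> kernel G (sym_group n) \<psi>"
      unfolding kernel_def using lam_carrier[OF ij(1)] ij(2) by (simp del: One_nat_def)
    then have "inv w \<otimes> lam i j \<otimes> w \<in> kernel G (sym_group n) \<psi>"
      using w(1) by (simp add: K.inv_op_closed1)
    moreover have "inv w \<otimes> lam i j \<otimes> w = s 1 \<otimes> r 1"
      using w base_carrier by (simp add: m_assoc del: One_nat_def) (simp add: m_assoc[symmetric] del: One_nat_def)
    ultimately show ?thesis by simp
  qed
  have "lam k l \<in> kernel G (sym_group n) \<psi>" if kl: "(k, l) \<in> ordered_pairs" for k l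
  proof -
    obtain w where w: "w \<in> carrier G" "lam k l = w \<otimes> (s 1 \<otimes> r 1) \<otimes> inv w"
      using ordered_pairs_conj[OF kl] by blast
    show ?thesis unfolding w(2) by (rule K.inv_op_closed2[OF w(1) base])
  qed
  then have "case_prod lam ` ordered_pairs \<subseteq> kernel G (sym_group n) \<psi>" by auto
  then have "P \<subseteq> kernel G (sym_group n) \<psi>"
    unfolding P_def by (rule generate_subgroup_incl[OF _ K.subgroup_axioms])
  then have "p \<in> kernel G (sym_group n) \<psi>" using p by (rule subsetD)
  then show ?thesis unfolding kernel_def by (simp del: One_nat_def)
qed

end

section \<open>The unrestricted virtual braid group\<close>

definition uvb_class :: "nat \<Rightarrow> uvb_gen gword \<Rightarrow> uvb_gen gword set" where
  "uvb_class n w = pres_rel (uvb_gens n) (uvb_rels n) `` {w}"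

lemma uvb_class_closed: "w \<in> gwords (uvb_gens n) \<Longrightarrow> uvb_class n w \<in> carrier (UVB n)"
  by (simp add: uvb_class_def UVB_def presented_class_closed)

lemma uvb_class_mult:
  "u \<in> gwords (uvb_gens n) \<Longrightarrow> v \<in> gwords (uvb_gens n) \<Longrightarrow>
    uvb_class n u \<otimes>\<^bsub>UVB n\<^esub> uvb_class n v = uvb_class n (u @ v)"
  by (simp add: uvb_class_def UVB_def presented_mult_class)

lemma uvb_class_Nil: "uvb_class n [] = \<one>\<^bsub>UVB n\<^esub>"
  by (simp add: uvb_class_def UVB_def presented_one)

lemma uvb_class_eqI: "pres_eq (uvb_gens n) (uvb_rels n) u v \<Longrightarrow> uvb_class n u = uvb_class n v"
  unfolding uvb_class_def by (intro equiv_class_eq[OF equiv_pres_rel]) (simp add: pres_rel_def)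

lemma uvb_class_rel: "(u, v) \<in> uvb_rels n \<Longrightarrow> uvb_class n u = uvb_class n v"
  using uvb_rels_gwords by (intro uvb_class_eqI pres_eq.relation) auto

lemma Sig_gens [simp]: "Sig i \<in> uvb_gens n \<longleftrightarrow> 1 \<le> i \<and> i < n"
  and Rho_gens [simp]: "Rho i \<in> uvb_gens n \<longleftrightarrow> 1 \<le> i \<and> i < n"
  by (auto simp: uvb_gens_def)

text \<open>Formal inverse letters are inverses of the corresponding classes, so that the generators suffice.\<close>

lemma UVB_generated: "carrier (UVB n) = generate (UVB n) ((\<lambda>x. uvb_class n [(x, True)]) ` uvb_gens n)"
proof
  interpret group "UVB n" by (rule group_UVB)
  let ?X = "(\<lambda>x. uvb_class n [(x, True)]) ` uvb_gens n"
  show "generate (UVB n) ?X \<subseteq> carrier (UVB n)"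
    by (intro generate_incl) (auto intro!: uvb_class_closed)
  show "carrier (UVB n) \<subseteq> generate (UVB n) ?X"
  proof
    fix g assume "g \<in> carrier (UVB n)"
    then obtain w where w: "w \<in> gwords (uvb_gens n)" "g = uvb_class n w"
      unfolding UVB_def uvb_class_def by (rule presented_carrier_cases)
    from w(1) have "uvb_class n w \<in> generate (UVB n) ?X"
    proof (induction w)
      case Nil
      then show ?case by (simp add: uvb_class_Nil generate.one)
    next
      case (Cons a w)
      obtain x b where a: "a = (x, b)" by fastforce
      have x: "x \<in> uvb_gens n" and w: "w \<in> gwords (uvb_gens n)" using Cons.prems a by auto
      have "uvb_class n [(x, False)] \<otimes>\<^bsub>UVB n\<^esub> uvb_class n [(x, True)] = \<one>\<^bsub>UVB n\<^esub>"
        using x pres_eq.cancel[of x "uvb_gens n" "uvb_rels n" False]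
        by (simp add: uvb_class_mult uvb_class_eqI flip: uvb_class_Nil)
      then have "inv\<^bsub>UVB n\<^esub> uvb_class n [(x, True)] = uvb_class n [(x, False)]"
        using x by (intro inv_equality) (auto intro: uvb_class_closed)
      then have "uvb_class n [a] \<in> generate (UVB n) ?X"
        using x by (cases b) (auto simp: a intro: generate.incl dest: generate.inv[of _ ?X "UVB n", OF imageI])
      moreover have "uvb_class n (a # w) = uvb_class n [a] \<otimes>\<^bsub>UVB n\<^esub> uvb_class n w"
        using x w by (simp add: uvb_class_mult a)
      ultimately show ?case using Cons.IH w by (simp add: generate.eng)
    qed
    then show "g \<in> generate (UVB n) ?X" using w(2) by simp
  qed
qed

lemma UVB_relations:
  assumes n: "4 \<le> n"
  shows "unrestricted_virtual_braid_relations (UVB n) n (\<lambda>i. uvb_class n (rh i)) (uvb_phi n)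
    (\<lambda>i. uvb_class n (sg i))"
proof -
  interpret group "UVB n" by (rule group_UVB)
  note rel = uvb_class_rel[of _ _ n, unfolded uvb_rels_def]
  have phi: "uvb_phi n (uvb_class n (rh i)) = transpose i (Suc i)"
    "uvb_phi n (uvb_class n (sg i)) = transpose i (Suc i)" if "i \<in> {1..<n}" for i
    using uvb_phi_gen[of "Rho i" n] uvb_phi_gen[of "Sig i" n] that by (simp_all add: uvb_class_def)
  have gens: "carrier (UVB n) = generate (UVB n)
      ((\<lambda>i. uvb_class n (sg i)) ` {1..<n} \<union> (\<lambda>i. uvb_class n (rh i)) ` {1..<n})"
    using UVB_generated[of n] by (simp add: uvb_gens_def image_Un image_image)
  show ?thesis
  proof unfold_locales
    fix i assume i: "i \<in> {1..<n}"
    show "uvb_class n (rh i) \<in> carrier (UVB n)" "uvb_class n (sg i) \<in> carrier (UVB n)"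
      using i by (auto intro!: uvb_class_closed)
    show "uvb_phi n (uvb_class n (rh i)) = transpose i (Suc i)"
      "uvb_phi n (uvb_class n (sg i)) = transpose i (Suc i)" using phi[OF i] by auto
    have "uvb_class n (rh i @ rh i) = uvb_class n []"
      using i by (intro uvb_class_rel) (auto simp: uvb_rels_def)
    then show "uvb_class n (rh i) \<otimes>\<^bsub>UVB n\<^esub> uvb_class n (rh i) = \<one>\<^bsub>UVB n\<^esub>"
      using i by (simp add: uvb_class_mult uvb_class_Nil)
  next
    fix i assume i: "1 \<le> i" "i + 2 \<le> n"
    have "(rh i @ rh (i+1) @ rh i, rh (i+1) @ rh i @ rh (i+1)) \<in> uvb_rels n"
      "(sg i @ sg (i+1) @ sg i, sg (i+1) @ sg i @ sg (i+1)) \<in> uvb_rels n"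
      "(sg i @ rh (i+1) @ rh i, rh (i+1) @ rh i @ sg (i+1)) \<in> uvb_rels n"
      "(rh i @ sg (i+1) @ sg i, sg (i+1) @ sg i @ rh (i+1)) \<in> uvb_rels n"
      "(rh (i+1) @ sg i @ sg (i+1), sg i @ sg (i+1) @ rh i) \<in> uvb_rels n"
      using i unfolding uvb_rels_def by blast+
    note this[THEN uvb_class_rel]
    then show "uvb_class n (rh i) \<otimes>\<^bsub>UVB n\<^esub> (uvb_class n (rh (Suc i)) \<otimes>\<^bsub>UVB n\<^esub> uvb_class n (rh i)) =
        uvb_class n (rh (Suc i)) \<otimes>\<^bsub>UVB n\<^esub> (uvb_class n (rh i) \<otimes>\<^bsub>UVB n\<^esub> uvb_class n (rh (Suc i)))"
      "uvb_class n (sg i) \<otimes>\<^bsub>UVB n\<^esub> (uvb_class n (sg (Suc i)) \<otimes>\<^bsub>UVB n\<^esub> uvb_class n (sg i)) =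
        uvb_class n (sg (Suc i)) \<otimes>\<^bsub>UVB n\<^esub> (uvb_class n (sg i) \<otimes>\<^bsub>UVB n\<^esub> uvb_class n (sg (Suc i)))"
      "uvb_class n (sg i) \<otimes>\<^bsub>UVB n\<^esub> (uvb_class n (rh (Suc i)) \<otimes>\<^bsub>UVB n\<^esub> uvb_class n (rh i)) =
        uvb_class n (rh (Suc i)) \<otimes>\<^bsub>UVB n\<^esub> (uvb_class n (rh i) \<otimes>\<^bsub>UVB n\<^esub> uvb_class n (sg (Suc i)))"
      "uvb_class n (rh i) \<otimes>\<^bsub>UVB n\<^esub> (uvb_class n (sg (Suc i)) \<otimes>\<^bsub>UVB n\<^esub> uvb_class n (sg i)) =
        uvb_class n (sg (Suc i)) \<otimes>\<^bsub>UVB n\<^esub> (uvb_class n (sg i) \<otimes>\<^bsub>UVB n\<^esub> uvb_class n (rh (Suc i)))"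
      "uvb_class n (rh (Suc i)) \<otimes>\<^bsub>UVB n\<^esub> (uvb_class n (sg i) \<otimes>\<^bsub>UVB n\<^esub> uvb_class n (sg (Suc i))) =
        uvb_class n (sg i) \<otimes>\<^bsub>UVB n\<^esub> (uvb_class n (sg (Suc i)) \<otimes>\<^bsub>UVB n\<^esub> uvb_class n (rh i))"
      using i by (simp_all add: uvb_class_mult)
  next
    fix i j assume far: "far n i j"
    have "(rh i @ rh j, rh j @ rh i) \<in> uvb_rels n" "(sg i @ sg j, sg j @ sg i) \<in> uvb_rels n"
      "(sg i @ rh j, rh j @ sg i) \<in> uvb_rels n"
      using far unfolding uvb_rels_def by blast+
    note this[THEN uvb_class_rel]
    then show "uvb_class n (rh i) \<otimes>\<^bsub>UVB n\<^esub> uvb_class n (rh j) = uvb_class n (rh j) \<otimes>\<^bsub>UVB n\<^esub> uvb_class n (rh i)"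
      "uvb_class n (sg i) \<otimes>\<^bsub>UVB n\<^esub> uvb_class n (sg j) = uvb_class n (sg j) \<otimes>\<^bsub>UVB n\<^esub> uvb_class n (sg i)"
      "uvb_class n (sg i) \<otimes>\<^bsub>UVB n\<^esub> uvb_class n (rh j) = uvb_class n (rh j) \<otimes>\<^bsub>UVB n\<^esub> uvb_class n (sg i)"
      using far by (simp_all add: uvb_class_mult far_def)
  qed (use n uvb_phi_hom gens in auto)
qed

theorem proposition2p15:
  fixes n :: nat
  assumes "n \<ge> 5"
  shows "characteristic_subgroup (UVP n) (UVB n)"
proof -
  interpret U: unrestricted_virtual_braid_relations "UVB n" n "\<lambda>i. uvb_class n (rh i)" "uvb_phi n"
    "\<lambda>i. uvb_class n (sg i)"
    using assms by (intro UVB_relations) simp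
  have UVP: "UVP n = U.P" by (simp add: UVP_def U.kernel_eq_P)
  have sub: "UVP n \<subseteq> carrier (UVB n)" by (auto simp: UVP_def kernel_def)
  have phi_surj: "uvb_phi n ` carrier (UVB n) = carrier (sym_group n)"
  proof
    show "uvb_phi n ` carrier (UVB n) \<subseteq> carrier (sym_group n)"
      using uvb_phi_hom by (auto simp: hom_def)
    show "carrier (sym_group n) \<subseteq> uvb_phi n ` carrier (UVB n)"
      using U.W_surj U.W_carrier[of 1] by (fastforce simp: sym_group_carrier)
  qed
  have into: "f ` UVP n \<subseteq> UVP n" if f: "f \<in> hom (UVB n) (UVB n)" "f ` carrier (UVB n) = carrier (UVB n)" for f
  proof
    fix y assume "y \<in> f ` UVP n"
    then obtain x where x: "x \<in> UVP n" "y = f x" by auto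
    have "uvb_phi n \<circ> f \<in> hom (UVB n) (sym_group n)"
      using hom_compose f(1) uvb_phi_hom by blast
    moreover have "(uvb_phi n \<circ> f) ` carrier (UVB n) = carrier (sym_group n)"
      using f(2) phi_surj by (simp only: image_comp[symmetric])
    ultimately have "(uvb_phi n \<circ> f) x = id"
      using U.surjective_hom_trivial_on_P[OF assms] x(1) UVP by blast
    then show "y \<in> UVP n"
      using x sub f(1) by (auto simp: UVP_def kernel_def hom_def sym_group_one)
  qed
  have "f ` UVP n = UVP n" if f: "f \<in> auto (UVB n)" for f
  proof
    have fh: "f \<in> hom (UVB n) (UVB n)" and fB: "f \<in> Bij (carrier (UVB n))"
      using f by (auto simp: auto_def)
    have bij: "bij_betw f (carrier (UVB n)) (carrier (UVB n))" using fB by (simp add: Bij_def)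
    show "f ` UVP n \<subseteq> UVP n"
      using into fh bij by (simp add: bij_betw_def)
    define g where "g = restrict (inv_into (carrier (UVB n)) f) (carrier (UVB n))"
    have "g ` carrier (UVB n) = carrier (UVB n)"
      using bij_betw_inv_into[OF bij] by (simp add: g_def bij_betw_def)
    then have "g ` UVP n \<subseteq> UVP n"
      using U.restrict_inv_into_hom[OF fh fB] by (intro into) (simp_all only: g_def)
    moreover have "f (g y) = y" if "y \<in> UVP n" for y
      using that sub bij by (simp add: g_def subset_iff bij_betw_inv_into_right)
    ultimately show "UVP n \<subseteq> f ` UVP n"
      by (metis image_eqI image_subset_iff subsetI)
  qed
  then show ?thesis
    using U.P_subgroup by (simp add: characteristic_subgroup_def UVP)
qed

end
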